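(* Let $A\in\mathbb{C}^{n\times n}$ and assume that $(e^{t(A-s(A))})_{t\ge0}$ is bounded (equivalently, every $\lambda\in\sigma_{\mathrm{per}}(A)$ is a simple pole of $R(\cdot,A)$). Then the following are equivalent: (i) $(e^{tA})_{t\ge0}$ is asymptotically positive. (ii) There is $c\in\mathbb{R}$ such that $A+cI$ has positive spectral radius $r(A+cI)>0$, $\frac{A+cI}{r(A+cI)}$ is power bounded, and $A+cI$ is asymptotically positive.
   Context: $\mathbb{C}^n$ is the complex Banach lattice with coordinatewise order (any lattice norm); $d_+(f)=\operatorname{dist}(f,\mathbb{C}^n_+)$. $s(A)$ is the spectral bound and $\sigma_{\mathrm{per}}(A)=\sigma(A)\cap(s(A)+i\mathbb{R})$. The semigroup is asymptotically positive if $d_+(e^{t(A-s(A))}f)\to0$ as $t\to\infty$ for every $f\ge0$. A matrix $T$ with $r(T)>0$ and $T/r(T)$ power bounded is asymptotically positive if $d_+((T/r(T))^kf)\to0$ as $k\to\infty$ for every $f\ge0$ (in finite dimensions individual and uniform versions coincide). *)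

theory Defs
  imports "HOL-Analysis.Analysis"
begin

text \<open>Complex n x n matrices are rendered as complex^'n^'n (n = CARD('n)).
  C^n carries the standard (Euclidean) norm, which is a lattice norm.\<close>

definition mpow :: "complex^'n^'n \<Rightarrow> nat \<Rightarrow> complex^'n^'n" where
  "mpow A k = (((**) A) ^^ k) (mat 1)"

definition mexp :: "real \<Rightarrow> complex^'n^'n \<Rightarrow> complex^'n^'n" where
  "mexp t A = (\<Sum>k. ((t ^ k) / fact k) *\<^sub>R mpow A k)"

definition spectrum_mat :: "complex^'n^'n \<Rightarrow> complex set" where
  "spectrum_mat A = {l. \<exists>v. v \<noteq> 0 \<and> A *v v = l *s v}"

definition spectral_bound :: "complex^'n^'n \<Rightarrow> real" where
  "spectral_bound A = Max (Re ` spectrum_mat A)"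

definition spectral_radius_mat :: "complex^'n^'n \<Rightarrow> real" where
  "spectral_radius_mat A = Max (norm ` spectrum_mat A)"

definition pos_cone :: "(complex^'n) set" where
  "pos_cone = {f. \<forall>i. f $ i \<in> \<real> \<and> Re (f $ i) \<ge> 0}"

definition d_plus :: "complex^'n \<Rightarrow> real" where
  "d_plus f = infdist f pos_cone"

definition semigroup_bounded :: "complex^'n^'n \<Rightarrow> bool" where
  "semigroup_bounded A \<longleftrightarrow> (\<exists>M. \<forall>t\<ge>0. \<forall>f.
     norm (mexp t (A - mat (complex_of_real (spectral_bound A))) *v f) \<le> M * norm f)"

definition semigroup_asymp_pos :: "complex^'n^'n \<Rightarrow> bool" where
  "semigroup_asymp_pos A \<longleftrightarrow> (\<forall>f \<in> pos_cone.
     ((\<lambda>t. d_plus (mexp t (A - mat (complex_of_real (spectral_bound A))) *v f))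
        \<longlongrightarrow> 0) at_top)"

definition power_bounded :: "complex^'n^'n \<Rightarrow> bool" where
  "power_bounded T \<longleftrightarrow> (\<exists>M. \<forall>k f. norm (mpow T k *v f) \<le> M * norm f)"

definition matrix_asymp_pos :: "complex^'n^'n \<Rightarrow> bool" where
  "matrix_asymp_pos T \<longleftrightarrow> (\<forall>f \<in> pos_cone.
     (\<lambda>k. d_plus (mpow ((1 / spectral_radius_mat T) *\<^sub>R T) k *v f)) \<longlonglongrightarrow> 0)"

end

theory Submission
  imports Defs "HOL-Computational_Algebra.Fundamental_Theorem_Algebra"
begin

text \<open>
  Split \<open>f = \<Sum> E\<^sub>\<lambda> f\<close> into generalized eigenvectors of \<open>A\<close>; boundedness makes the peripheral
  ones genuine eigenvectors, so up to a null term an orbit is a trigonometric sum with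
  coefficients \<open>E\<^sub>\<lambda> f\<close>. If such a sum \<open>\<Sum> z\<^sub>i\<^sup>k a\<^sub>i\<close> with \<open>\<bar>z\<^sub>i\<bar> \<le> 1\<close> is asymptotically
  positive, Cesaro means show that the coefficient of \<open>z = 1\<close> dominates the modulus of every other
  unimodular coefficient (a weak Perron--Frobenius theorem). For powers of \<open>A + c\<close> this gives that
  \<open>r(A + c)\<close> is an eigenvalue with positive spectral projection, hence it is \<open>s(A) + c\<close> and the
  only point of \<open>A + c\<close> on its vertical line.

  Conversely, let the semigroup be asymptotically positive and \<open>s(A) = 0\<close>. By recurrence its
  peripheral part \<open>S\<^sub>t\<close> is positive for all real \<open>t\<close>. For small \<open>t > 0\<close> continuity yields
  \<open>2 S\<^sub>t - S\<^sub>0 \<ge> 0\<close>, because an entry that vanishes in \<open>S\<^sub>0\<close> stays nonnegative in \<open>S\<^sub>t\<close>. The eigenvalues of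
  this operator are \<open>2 w - 1\<close> with \<open>w = e\<^sup>t\<^sup>\<lambda>\<close> unimodular: of modulus above 1 if \<open>w \<noteq> 1\<close>, but never a real
  number above 1. By the weak Perron--Frobenius theorem only \<open>\<lambda> = 0\<close> is peripheral, so for large
  \<open>c\<close> the eigenvalue \<open>c\<close> strictly dominates all others of \<open>A + c\<close>.
\<close>

subsection \<open>Spectral decomposition\<close>

definition poly_act :: "complex^'n^'n \<Rightarrow> complex poly \<Rightarrow> complex^'n \<Rightarrow> complex^'n" where
  "poly_act A p v = fold_coeffs (\<lambda>a u. a *s v + A *v u) p 0"

lemma mat_mult_vec [simp]: "mat c *v (v::complex^'n) = c *s v"
proof -
  have "mat c *v v = (\<chi> i. \<Sum>j\<in>UNIV. if i = j then c * v $ j else 0)"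
    unfolding matrix_vector_mult_def mat_def vec_eq_iff vec_lambda_beta
    by (intro allI sum.cong) auto
  then show ?thesis by (simp add: vec_eq_iff)
qed

lemma scaleR_mult_vec [simp]: "(a *\<^sub>R T) *v (v::complex^'n) = a *\<^sub>R (T *v v)"
  by (simp add: matrix_vector_mult_def vec_eq_iff scaleR_right.sum)

lemma scaleR_eq_smult: "a *\<^sub>R (v::complex^'n) = complex_of_real a *s v"
  unfolding vec_eq_iff vector_scaleR_component vector_smult_component
  by (simp add: scaleR_conv_of_real)

lemma norm_smult_vec [simp]: "norm (c *s (v::complex^'n)) = cmod c * norm v"
  by (simp add: norm_vec_def norm_mult L2_set_right_distrib)

lemma poly_act_0 [simp]: "poly_act A 0 v = 0"
  by (simp add: poly_act_def)

lemma poly_act_pCons [simp]: "poly_act A (pCons a p) v = a *s v + A *v poly_act A p v"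
  by (cases "a = 0 \<and> p = 0") (auto simp: poly_act_def)

lemma poly_act_1 [simp]: "poly_act A 1 v = v"
  by (simp add: one_pCons)

lemma poly_act_add: "poly_act A (p + q) v = poly_act A p v + poly_act A q v"
  by (induction p q rule: poly_induct2)
     (simp_all add: algebra_simps matrix_vector_right_distrib vec.scale_left_distrib)

lemma poly_act_smult: "poly_act A (smult c p) v = c *s poly_act A p v"
  by (induction p) (simp_all add: vec.scale_right_distrib vector_scalar_commute)

text \<open>Makes the vectors a module over the polynomial ring, so that divisibility between
  polynomials turns into relations between operators.\<close>

lemma poly_act_mult: "poly_act A (p * q) v = poly_act A p (poly_act A q v)"
  by (induction p) (simp_all add: poly_act_add poly_act_smult)

lemma poly_act_sum: "poly_act A (\<Sum>i\<in>I. p i) v = (\<Sum>i\<in>I. poly_act A (p i) v)"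
  by (induction I rule: infinite_finite_induct) (simp_all add: poly_act_add)

lemma poly_act_monom: "poly_act A (monom c k) v = c *s ((*v) A ^^ k) v"
  by (induction k) (simp_all add: monom_0 monom_Suc vector_scalar_commute)

lemma poly_act_vec_add: "poly_act A p (u + v) = poly_act A p u + poly_act A p v"
  by (induction p) (simp_all add: algebra_simps matrix_vector_right_distrib vec.scale_right_distrib)

lemma poly_act_vec_smult: "poly_act A p (c *s v) = c *s poly_act A p v"
  by (induction p) (simp_all add: vec.scale_right_distrib vector_scalar_commute mult.commute)

lemma poly_act_commute: "poly_act A p (A *v v) = A *v poly_act A p v"
  by (induction p) (simp_all add: matrix_vector_right_distrib vector_scalar_commute)

lemma poly_act_linear_power:
  "poly_act A ([:-l, 1:] ^ k) v = ((*v) (A - mat l) ^^ k) v"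
proof (induction k)
  case (Suc k)
  have "poly_act A [:-l, 1:] u = (A - mat l) *v u" for u
    by (simp add: matrix_vector_mult_diff_rdistrib)
  with Suc show ?case by (simp only: power_Suc poly_act_mult funpow.simps o_apply)
qed simp

lemma linear_poly_act: "Vector_Spaces.linear (*s) (*s) (poly_act A p)"
  by unfold_locales (simp_all add: poly_act_vec_add poly_act_vec_smult)

lemma mpow_mult_vec: "mpow T k *v v = ((*v) T ^^ k) v"
  by (induction k) (simp_all add: mpow_def flip: matrix_vector_mul_assoc)

text \<open>Powers of \<open>A\<close> lie in a finite-dimensional space, and a linear dependency
  among them is a polynomial. If two powers coincide, the set of powers may be too small for this
  argument; the difference of the two monomials then serves directly.\<close>

lemma annihilating_polynomial:
  fixes A :: "complex^'n^'n"
  obtains p where "p \<noteq> 0" "\<And>v. poly_act A p v = 0"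
proof (cases "inj (mpow A)")
  case True
  \<comment> \<open>The dimension is over the reals, whence the real coefficients \<open>u\<close>
    below; one power more than the dimension forces a dependency.\<close>
  define n where "n = Suc DIM(complex^'n^'n)"
  have inj: "inj_on (mpow A) {..<n}"
    using True by (rule inj_on_subset) simp
  have "dependent (mpow A ` {..<n})"
    by (rule dependent_biggerset, unfold card_image[OF inj]) (simp add: n_def)
  then obtain u where u: "\<exists>X\<in>mpow A ` {..<n}. u X \<noteq> 0"
      "(\<Sum>X\<in>mpow A ` {..<n}. u X *\<^sub>R X) = 0"
    by (subst (asm) dependent_finite) auto
  define p where "p = (\<Sum>k<n. monom (complex_of_real (u (mpow A k))) k)"
  show thesis
  proof (rule that)
    from u(1) obtain k where k: "k < n" "u (mpow A k) \<noteq> 0" by auto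
    have "coeff p k = u (mpow A k)"
      using k(1) by (simp add: p_def coeff_sum)
    with k(2) show "p \<noteq> 0" by auto
  next
    fix v
    have lin: "linear (\<lambda>X::complex^'n^'n. X *v v)"
      by (rule linearI) (simp_all add: matrix_vector_mult_add_rdistrib)
    have "poly_act A p v = (\<Sum>k<n. u (mpow A k) *\<^sub>R mpow A k) *v v"
      by (simp add: p_def poly_act_sum poly_act_monom linear_sum[OF lin] scaleR_eq_smult mpow_mult_vec)
    also have "(\<Sum>k<n. u (mpow A k) *\<^sub>R mpow A k) = 0"
      using u(2) by (simp add: sum.reindex[OF inj])
    finally show "poly_act A p v = 0" by simp
  qed
next
  case False
  then obtain i j where ij: "i \<noteq> j" "mpow A i = mpow A j"
    by (auto simp: inj_def)
  show thesis
  proof (rule that)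
    have "coeff (monom (1::complex) i + smult (-1) (monom 1 j)) i = 1"
      using ij(1) by simp
    then show "monom (1::complex) i + smult (-1) (monom 1 j) \<noteq> 0" by (metis coeff_0 zero_neq_one)
    show "poly_act A (monom 1 i + smult (-1) (monom 1 j)) v = 0" for v
      by (simp only: poly_act_add poly_act_smult poly_act_monom flip: mpow_mult_vec)
         (simp add: ij(2) vec_eq_iff)
  qed
qed

text \<open>Since p is congruent to its value at x modulo X - x, a combination c p - c q (X - x)
  equals 1. Multiplying this into the second summand of the identity for m yields one more factor X
  - x.\<close>

lemma bezout_linear_power:
  fixes p :: "'a::field poly"
  assumes "poly p x \<noteq> 0"
  shows "\<exists>a b. a * p + b * [:-x, 1:] ^ m = 1"
proof (induction m)
  case 0
  have "0 * p + 1 * [:-x, 1:] ^ 0 = 1" by simp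
  then show ?case by blast
next
  case (Suc m)
  then obtain a b where ab: "a * p + b * [:-x, 1:] ^ m = 1" by blast
  have "[:-x, 1:] dvd p - [:poly p x:]"
    by (simp flip: poly_eq_0_iff_dvd)
  then obtain q where q: "p - [:poly p x:] = [:-x, 1:] * q" by (elim dvdE)
  define c where "c = [:inverse (poly p x):]"
  have "c * p - c * q * [:-x, 1:] = c * (p - [:-x, 1:] * q)"
    by (simp only: right_diff_distrib mult_ac)
  also have "p - [:-x, 1:] * q = [:poly p x:]"
    by (simp only: q[symmetric]) simp
  also have "c * [:poly p x:] = 1"
    using assms by (simp add: c_def one_pCons)
  finally have c: "c * p - c * q * [:-x, 1:] = 1" .
  have "b * [:-x, 1:] ^ m = b * [:-x, 1:] ^ m * (c * p - c * q * [:-x, 1:])"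
    unfolding c by simp
  then have "1 = a * p + b * [:-x, 1:] ^ m * (c * p - c * q * [:-x, 1:])"
    unfolding c using ab by simp
  also have "\<dots> = (a + b * [:-x, 1:] ^ m * c) * p + (- b * c * q) * [:-x, 1:] ^ Suc m"
    by (simp add: algebra_simps)
  finally show ?case by metis
qed

text \<open>The polynomials \<open>q x\<close>, evaluated at a matrix annihilated by the product,
  become its spectral projections. A new root z splits 1 as a P + b (X - z)^m with P the old
  product: the first summand becomes the polynomial for z, the second multiplies the old
  ones.\<close>

lemma primary_partition_of_unity:
  fixes m :: "'a::field \<Rightarrow> nat"
  assumes "finite S"
  shows "\<exists>q. (S \<noteq> {} \<longrightarrow> (\<Sum>x\<in>S. q x) = 1) \<and>
    (\<forall>x\<in>S. (\<Prod>y\<in>S. [:-y, 1:] ^ m y) dvd [:-x, 1:] ^ m x * q x)"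
  using assms
proof (induction S)
  case empty
  then show ?case by simp
next
  case (insert z S)
  let ?P = "\<Prod>y\<in>S. [:-y, 1:] ^ m y"
  obtain q where q: "S \<noteq> {} \<longrightarrow> (\<Sum>x\<in>S. q x) = 1"
      "\<And>x. x \<in> S \<Longrightarrow> ?P dvd [:-x, 1:] ^ m x * q x"
    using insert.IH by blast
  have "poly ?P z \<noteq> 0"
    using insert.hyps by (auto simp: poly_prod)
  then obtain a b where ab: "a * ?P + b * [:-z, 1:] ^ m z = 1"
    using bezout_linear_power by blast
  \<comment> \<open>For empty \<open>S\<close> there is no decomposition of 1 to refine, so the
    first root receives 1 itself.\<close>
  define r where "r = (\<lambda>x. if S = {} then 1 else if x = z then a * ?P else q x * (b * [:-z, 1:] ^ m z))"
  have "(\<Sum>x\<in>insert z S. r x) = 1"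
  proof (cases "S = {}")
    case False
    have "(\<Sum>x\<in>S. r x) = (\<Sum>x\<in>S. q x) * (b * [:-z, 1:] ^ m z)"
      unfolding sum_distrib_right using False insert.hyps by (intro sum.cong) (auto simp: r_def)
    then show ?thesis
      using False q(1) ab insert.hyps by (simp add: r_def)
  qed (simp add: r_def)
  moreover have "(\<Prod>y\<in>insert z S. [:-y, 1:] ^ m y) dvd [:-x, 1:] ^ m x * r x"
    if x: "x \<in> insert z S" for x
  proof (cases "x = z")
    case True
    then show ?thesis
      using insert.hyps by (auto simp: r_def intro: mult_dvd_mono)
  next
    case False
    with x have "x \<in> S" by simp
    then have "[:-z, 1:] ^ m z * ?P dvd ([:-z, 1:] ^ m z * b) * ([:-x, 1:] ^ m x * q x)"
      by (intro mult_dvd_mono q(2)) auto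
    then show ?thesis
      using insert.hyps False \<open>x \<in> S\<close> by (auto simp: r_def mult_ac)
  qed
  ultimately show ?case by blast
qed

text \<open>\<open>E l\<close> stands for the projection onto the generalized eigenspace of
  \<open>l\<close>, and \<open>m l\<close> for a bound on the nilpotency index there. Idempotence
  and orthogonality are not demanded; on eigenvectors they follow from commutation with
  \<open>A\<close>.\<close>

definition spectral_family :: "complex^'n^'n \<Rightarrow> (complex \<Rightarrow> complex^'n^'n) \<Rightarrow> (complex \<Rightarrow> nat) \<Rightarrow> bool" where
  "spectral_family A E m \<longleftrightarrow> finite (spectrum_mat A)
     \<and> (\<forall>f. (\<Sum>l\<in>spectrum_mat A. E l *v f) = f)
     \<and> (\<forall>l\<in>spectrum_mat A. \<forall>f. ((*v) (A - mat l) ^^ m l) (E l *v f) = 0)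
     \<and> (\<forall>l\<in>spectrum_mat A. \<forall>f. E l *v (A *v f) = A *v (E l *v f))"

section \<open>Existence of the spectral projections\<close>

lemma funpow_eigenvector:
  assumes "T *v v = c *s v"
  shows "((*v) T ^^ k) v = c ^ k *s (v::complex^'n)"
  by (induction k) (simp_all add: vector_scalar_commute assms mult.commute)

text \<open>By commutation \<open>A - mat l\<close> acts on the image of v as the nonzero scalar c -
  l, and no power of a nonzero scalar kills a nonzero vector.\<close>

lemma commuting_eigenvector_zero:
  assumes "A *v v = c *s v" and "E *v (A *v v) = A *v (E *v v)"
    and "((*v) (A - mat l) ^^ m) (E *v v) = 0" and "c \<noteq> l"
  shows "E *v (v::complex^'n) = 0"
proof -
  have "(A - mat l) *v (E *v v) = (c - l) *s (E *v v)"
    using assms(1,2) by (simp add: algebra_simps vector_scalar_commute)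
  from funpow_eigenvector[OF this, of m] assms(3,4) show ?thesis by simp
qed

lemma spectral_family_exists:
  fixes A :: "complex^'n^'n"
  obtains E m where "spectral_family A E m"
proof -
  obtain p where p: "p \<noteq> 0" "\<And>v. poly_act A p v = 0"
    using annihilating_polynomial[of A] by blast
  define S where "S = {z. poly p z = 0}"
  define m where "m = (\<lambda>z. order z p)"
  let ?P = "\<Prod>y\<in>S. [:-y, 1:] ^ m y"
  have fin: "finite S" unfolding S_def by (rule poly_roots_finite[OF p(1)])
  obtain q where q: "S \<noteq> {} \<Longrightarrow> (\<Sum>x\<in>S. q x) = 1"
      "\<And>x. x \<in> S \<Longrightarrow> ?P dvd [:-x, 1:] ^ m x * q x"
    using primary_partition_of_unity[OF fin, of m] by blast
  have P: "poly_act A ?P v = 0" for v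
  proof -
    have "smult (lead_coeff p) ?P = p"
      unfolding S_def m_def by (rule complex_poly_decompose)
    then have "lead_coeff p *s poly_act A ?P v = 0"
      using p(2)[of v] by (simp flip: poly_act_smult)
    with p(1) show ?thesis by simp
  qed
  \<comment> \<open>Otherwise the empty product 1 would annihilate every vector.\<close>
  have "S \<noteq> {}"
  proof
    assume "S = {}"
    then have "v = 0" for v :: "complex^'n"
      using P[of v] by simp
    from this[of "axis undefined 1"] show False by (simp add: axis_eq_0_iff)
  qed
  define E where "E = (\<lambda>l. matrix (poly_act A (q l)))"
  have E: "E l *v f = poly_act A (q l) f" for l f
    unfolding E_def by (rule matrix_works[OF linear_poly_act])
  have sum: "(\<Sum>l\<in>S. E l *v f) = f" for f
    using q(1)[OF \<open>S \<noteq> {}\<close>] by (simp add: E flip: poly_act_sum)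
  have nil: "((*v) (A - mat l) ^^ m l) (E l *v f) = 0" if "l \<in> S" for l f
  proof -
    from q(2)[OF that] obtain r where "[:-l, 1:] ^ m l * q l = r * ?P" by (metis dvdE mult.commute)
    then have "poly_act A ([:-l, 1:] ^ m l * q l) f = poly_act A r 0"
      by (simp add: poly_act_mult P)
    also have "poly_act A r 0 = 0"
      using poly_act_vec_smult[of A r 0 0] by simp
    finally show ?thesis by (simp add: poly_act_mult E poly_act_linear_power)
  qed
  have com: "E l *v (A *v f) = A *v (E l *v f)" for l f
    by (simp add: E poly_act_commute)
  \<comment> \<open>An eigenvector for a value outside \<open>S\<close> would be killed by every
    \<open>E l\<close>, although it is the sum of its images.\<close>
  have sub: "spectrum_mat A \<subseteq> S"
  proof
    fix c assume "c \<in> spectrum_mat A"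
    then obtain v where v: "v \<noteq> 0" "A *v v = c *s v" by (auto simp: spectrum_mat_def)
    show "c \<in> S"
    proof (rule ccontr)
      assume "c \<notin> S"
      then have "E l *v v = 0" if "l \<in> S" for l
        using commuting_eigenvector_zero[OF v(2) com nil[OF that]] that by blast
      with sum[of v] v(1) show False by simp
    qed
  qed
  have "E l *v f = 0" if "l \<in> S - spectrum_mat A" for l f
  proof -
    \<comment> \<open>At a root that is no eigenvalue \<open>A - mat l\<close> is injective, so its
      powers have trivial kernel.\<close>
    have "u = 0" if "((*v) (A - mat l) ^^ k) u = 0" for k u
      using that
    proof (induction k)
      case (Suc k)
      define w where "w = ((*v) (A - mat l) ^^ k) u"
      have "A *v w = l *s w"
        using Suc.prems unfolding funpow.simps o_apply w_def[symmetric]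
        by (simp add: matrix_vector_mult_diff_rdistrib)
      then have "w = 0"
        using \<open>l \<in> S - spectrum_mat A\<close> by (auto simp: spectrum_mat_def)
      then show ?case unfolding w_def by (rule Suc.IH)
    qed simp
    then show ?thesis using nil that by blast
  qed
  then have "(\<Sum>l\<in>spectrum_mat A. E l *v f) = f" for f
    using sum.mono_neutral_left[OF fin sub, of "\<lambda>l. E l *v f"] sum[of f] by auto
  then have "spectral_family A E m"
    using finite_subset[OF sub fin] nil com sub by (auto simp: spectral_family_def)
  then show thesis by (rule that)
qed

subsection \<open>Powers and exponentials on generalized eigenvectors\<close>

lemma mpow_0 [simp]: "mpow T 0 *v w = w"
  by (simp add: mpow_mult_vec)

lemma mpow_Suc: "mpow T (Suc k) *v w = T *v (mpow T k *v w)"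
  by (simp add: mpow_mult_vec)

lemma mpow_Suc_right: "mpow T (Suc k) *v w = mpow T k *v (T *v w)"
  by (simp add: mpow_mult_vec funpow_swap1)

lemma mult_split_eigenvalue: "T *v (w::complex^'n) = l *s w + (T - mat l) *v w"
  by (simp add: matrix_vector_mult_diff_rdistrib)

text \<open>Binomial expansion of (l + N)^k with N = T - l, cut off at m because N^m kills
  w.\<close>

lemma mpow_generalized_eigenvector:
  fixes T :: "complex^'n^'n"
  assumes "((*v) (T - mat l) ^^ m) w = 0"
  shows "mpow T k *v w =
    (\<Sum>j<m. (of_nat (k choose j) * l ^ (k - j)) *s ((*v) (T - mat l) ^^ j) w)"
proof (cases m)
  case 0
  with assms show ?thesis by simp
next
  case (Suc n)
  define N where "N = (\<lambda>j. ((*v) (T - mat l) ^^ j) w)"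
  define a where "a = (\<lambda>k j. of_nat (k choose j) * l ^ (k - j))"
  have N: "T *v N j = l *s N j + N (Suc j)" for j
    unfolding N_def funpow.simps o_apply by (rule mult_split_eigenvalue)
  have zero: "N (Suc n) = 0" using assms Suc unfolding N_def by blast
  \<comment> \<open>Pascal's rule. For j \<ge> k the truncated subtraction in the exponent does no
    harm, since \<open>k choose Suc j\<close> is 0.\<close>
  have a: "a (Suc k) (Suc j) = l * a k (Suc j) + a k j" for k j
  proof (cases "j < k")
    case True
    then have "l ^ (k - j) = l * l ^ (k - Suc j)"
      by (metis Suc_diff_Suc power_Suc)
    then show ?thesis by (simp add: a_def algebra_simps)
  qed (simp add: a_def)
  have "mpow T k *v w = (\<Sum>j<Suc n. a k j *s N j)"
  proof (induction k)
    case 0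
    show ?case unfolding sum.lessThan_Suc_shift by (simp add: a_def N_def)
  next
    case (Suc k)
    have "mpow T (Suc k) *v w = (\<Sum>j<Suc n. a k j *s (T *v N j))"
      unfolding mpow_Suc Suc.IH
      by (simp add: vec.linear_sum[OF matrix_vector_mul_linear_gen] vector_scalar_commute
          matrix_vector_right_distrib)
    also have "\<dots> = (\<Sum>j<Suc n. (l * a k j) *s N j) + (\<Sum>j<Suc n. a k j *s N (Suc j))"
      unfolding N vec.scale_right_distrib sum.distrib by (simp add: mult.commute)
    also have "(\<Sum>j<Suc n. a k j *s N (Suc j)) = (\<Sum>j<n. a k j *s N (Suc j))"
      by (simp add: zero)
    also have "(\<Sum>j<Suc n. (l * a k j) *s N j) + \<dots> =
      a (Suc k) 0 *s N 0 + (\<Sum>j<n. (l * a k (Suc j)) *s N (Suc j) + a k j *s N (Suc j))"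
      unfolding sum.lessThan_Suc_shift sum.distrib by (simp add: a_def)
    also have "\<dots> = (\<Sum>j<Suc n. a (Suc k) j *s N j)"
      unfolding sum.lessThan_Suc_shift a by (simp add: vec.scale_left_distrib)
    finally show ?case .
  qed
  then show ?thesis by (simp add: Suc a_def N_def)
qed

text \<open>Induction on the nilpotency order: T w = l w + u with u of lower order, so the norms
  satisfy x_(k+1) \<le> |l| x_k + C r^k, which avoids estimating binomial coefficients.\<close>

lemma mpow_geometric_bound:
  fixes T :: "complex^'n^'n"
  assumes "((*v) (T - mat l) ^^ m) w = 0" and "cmod l < r"
  shows "\<exists>C. \<forall>k. norm (mpow T k *v w) \<le> C * r ^ k"
  using assms(1)
proof (induction m arbitrary: w)
  case 0
  then show ?case by (intro exI[of _ 0]) auto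
next
  case (Suc m)
  let ?u = "(T - mat l) *v w"
  have "((*v) (T - mat l) ^^ m) ?u = 0"
    using Suc.prems unfolding funpow_Suc_right o_apply .
  from Suc.IH[OF this] obtain C where C: "\<And>k. norm (mpow T k *v ?u) \<le> C * r ^ k"
    by blast
  \<comment> \<open>The least constant that covers k = 0 and satisfies |l| D + C \<le> r D, which
    carries the bound from k to k + 1.\<close>
  define D where "D = max (norm w) (C / (r - cmod l))"
  have D: "norm w \<le> D" "C \<le> D * (r - cmod l)"
  proof -
    have "C / (r - cmod l) \<le> D" by (simp add: D_def)
    then show "C \<le> D * (r - cmod l)" using assms(2) by (simp add: pos_divide_le_eq)
  qed (simp add: D_def)
  have r: "r > 0" using assms(2) norm_ge_zero[of l] by linarith
  have "norm (mpow T k *v w) \<le> D * r ^ k" for k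
  proof (induction k)
    case 0
    with D show ?case by simp
  next
    case (Suc k)
    have "mpow T (Suc k) *v w = l *s (mpow T k *v w) + mpow T k *v ?u"
      unfolding mpow_Suc_right
      by (subst mult_split_eigenvalue[of _ _ l])
         (simp only: matrix_vector_right_distrib vector_scalar_commute)
    then have "norm (mpow T (Suc k) *v w) \<le> cmod l * norm (mpow T k *v w) + norm (mpow T k *v ?u)"
      by (metis norm_smult_vec norm_triangle_ineq)
    also have "\<dots> \<le> cmod l * (D * r ^ k) + C * r ^ k"
      by (intro add_mono mult_left_mono Suc C) auto
    also have "\<dots> \<le> cmod l * (D * r ^ k) + (D * (r - cmod l)) * r ^ k"
      using D(2) r by (intro add_left_mono mult_right_mono) auto
    also have "\<dots> = D * r ^ Suc k" by (simp add: algebra_simps)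
    finally show ?case .
  qed
  then show ?case by blast
qed

lemma mpow_decay:
  fixes T :: "complex^'n^'n"
  assumes "((*v) (T - mat l) ^^ m) w = 0" and "cmod l < 1"
  shows "(\<lambda>k. mpow T k *v w) \<longlonglongrightarrow> 0"
proof -
  obtain r where r: "cmod l < r" "r < 1" using dense[OF assms(2)] by blast
  obtain C where C: "\<And>k. norm (mpow T k *v w) \<le> C * r ^ k"
    using mpow_geometric_bound[OF assms(1) r(1)] by blast
  have "0 \<le> r" using r(1) norm_ge_zero[of l] by linarith
  then have "(\<lambda>k. C * r ^ k) \<longlonglongrightarrow> 0"
    using r(2) by (intro tendsto_mult_right_zero LIMSEQ_power_zero) simp
  then show ?thesis
    by (rule Lim_null_comparison[rotated]) (simp add: C)
qed

section \<open>The exponential series and its action on generalized eigenvectors\<close>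

lemma mult_axis_component: "((T::complex^'n^'n) *v axis j 1) $ i = T $ i $ j"
proof -
  have "(T *v axis j 1) $ i = (\<Sum>k\<in>UNIV. if k = j then T $ i $ k else 0)"
    unfolding matrix_vector_mult_def axis_def vec_lambda_beta by (intro sum.cong) auto
  then show ?thesis by simp
qed

text \<open>Matrix entries are coordinates of the images of unit vectors, and convergence of
  matrices is entrywise.\<close>

lemma summable_matrixI:
  fixes X :: "nat \<Rightarrow> complex^'n^'n"
  assumes "\<And>f. summable (\<lambda>k. X k *v f)"
  shows "summable X"
proof -
  define S where "S = (\<chi> i j. (\<Sum>k. X k *v axis j 1) $ i)"
  have "(\<lambda>n. (\<Sum>k<n. X k) $ i $ j) \<longlonglongrightarrow> S $ i $ j" for i j
  proof -
    have "(\<lambda>n. (\<Sum>k<n. X k *v axis j 1) $ i) \<longlonglongrightarrow> (\<Sum>k. X k *v axis j 1) $ i"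
      using summable_LIMSEQ[OF assms] by (rule tendsto_vec_nth)
    then show ?thesis
      by (simp add: S_def mult_axis_component)
  qed
  then have "X sums S"
    unfolding sums_def by (intro vec_tendstoI)
  then show ?thesis by (rule sums_summable)
qed

text \<open>The infinite sum in \<open>mexp\<close> carries information only once it converges.
  Comparison with the scalar series for exp(|t| K), K an operator bound, gives this on each vector,
  hence for matrices; evaluation at f is continuous.\<close>

lemma mexp_sums:
  fixes T :: "complex^'n^'n"
  shows "(\<lambda>k. (t ^ k / fact k) *\<^sub>R (mpow T k *v f)) sums (mexp t T *v f)"
proof -
  obtain K where K: "K > 0" "\<And>x. norm (T *v x) \<le> norm x * K"
    using bounded_linear.pos_bounded[of "(*v) T"] by (auto simp flip: linear_conv_bounded_linear)
  have bound: "norm (mpow T k *v f) \<le> norm f * K ^ k" for k f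
  proof (induction k)
    case (Suc k)
    have "norm (mpow T (Suc k) *v f) \<le> norm (mpow T k *v f) * K"
      unfolding mpow_Suc by (rule K)
    also have "\<dots> \<le> norm f * K ^ k * K"
      using Suc K(1) by (intro mult_right_mono) auto
    finally show ?case by (simp add: mult_ac)
  qed simp
  have sum: "summable (\<lambda>k. (t ^ k / fact k) *\<^sub>R (mpow T k *v f))" for f
  proof (rule summable_comparison_test')
    show "summable (\<lambda>k. norm f * (inverse (fact k) * (\<bar>t\<bar> * K) ^ k))"
      by (intro summable_mult summable_exp)
    show "norm ((t ^ k / fact k) *\<^sub>R (mpow T k *v f)) \<le> norm f * (inverse (fact k) * (\<bar>t\<bar> * K) ^ k)"
      if "k \<ge> 0" for k
      using mult_left_mono[OF bound[of k f], of "\<bar>t\<bar> ^ k / fact k"]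
      by (simp add: power_abs power_mult_distrib field_simps)
  qed
  have "summable (\<lambda>k. (t ^ k / fact k) *\<^sub>R mpow T k)"
    by (rule summable_matrixI) (simp add: sum)
  then have "(\<lambda>k. (t ^ k / fact k) *\<^sub>R mpow T k) sums mexp t T"
    unfolding mexp_def by (rule summable_sums)
  moreover have "bounded_linear (\<lambda>X::complex^'n^'n. X *v f)"
    unfolding linear_conv_bounded_linear[symmetric]
    by (rule linearI) (simp_all add: matrix_vector_mult_add_rdistrib)
  ultimately have "(\<lambda>k. ((t ^ k / fact k) *\<^sub>R mpow T k) *v f) sums (mexp t T *v f)"
    by (rule bounded_linear.sums[rotated])
  then show ?thesis by simp
qed

text \<open>The first j terms vanish; after a shift by j the factorials cancel and the exponential
  series remains.\<close>

lemma binomial_exp_sums: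
  fixes l :: complex
  shows "(\<lambda>k. complex_of_real (t ^ k / fact k) * (of_nat (k choose j) * l ^ (k - j))) sums
    (complex_of_real (t ^ j / fact j) * exp (complex_of_real t * l))"
proof -
  let ?g = "\<lambda>k. complex_of_real (t ^ k / fact k) * (of_nat (k choose j) * l ^ (k - j))"
  have eq: "?g (i + j) = complex_of_real (t ^ j / fact j) * ((complex_of_real t * l) ^ i /\<^sub>R fact i)" for i
  proof -
    have "of_nat ((i + j) choose j) = (fact (i + j) / (fact j * fact i) :: complex)"
      using binomial_fact[of j "i + j"] by simp
    then show ?thesis
      by (simp add: power_add power_mult_distrib scaleR_conv_of_real field_simps)
  qed
  have "(\<lambda>i. ?g (i + j)) sums (complex_of_real (t ^ j / fact j) * exp (complex_of_real t * l))"
    unfolding eq by (intro sums_mult exp_converges)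
  then show ?thesis
    by (subst (asm) sums_zero_iff_shift) (auto simp: binomial_eq_0)
qed

text \<open>This is e^(tl) e^(tN) w with N = T - l nilpotent on w, obtained by summing the binomial
  formula for powers over k separately for each j.\<close>

lemma mexp_generalized_eigenvector:
  fixes T :: "complex^'n^'n"
  assumes "((*v) (T - mat l) ^^ m) w = 0"
  shows "mexp t T *v w = exp (complex_of_real t * l) *s
    (\<Sum>j<m. complex_of_real (t ^ j / fact j) *s ((*v) (T - mat l) ^^ j) w)"
proof -
  let ?N = "\<lambda>j. ((*v) (T - mat l) ^^ j) w"
  let ?c = "\<lambda>j k. complex_of_real (t ^ k / fact k) * (of_nat (k choose j) * l ^ (k - j))"
  have eq: "(t ^ k / fact k) *\<^sub>R (mpow T k *v w) = (\<Sum>j<m. ?c j k *s ?N j)" for k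
    unfolding mpow_generalized_eigenvector[OF assms] scaleR_eq_smult
    by (simp only: vec.scale_sum_right vec.scale_scale)
  have sums: "(\<lambda>k. \<Sum>j<m. ?c j k *s ?N j) sums
      (\<Sum>j<m. (complex_of_real (t ^ j / fact j) * exp (complex_of_real t * l)) *s ?N j)"
  proof (rule sums_sum)
    fix j
    have "bounded_linear (\<lambda>c. c *s ?N j)"
      unfolding linear_conv_bounded_linear[symmetric]
      by (rule linearI, rule vec.scale_left_distrib)
        (simp add: vec_eq_iff)
    then show "(\<lambda>k. ?c j k *s ?N j) sums
        ((complex_of_real (t ^ j / fact j) * exp (complex_of_real t * l)) *s ?N j)"
      by (rule bounded_linear.sums) (rule binomial_exp_sums)
  qed
  show ?thesis
    unfolding sums_unique2[OF mexp_sums[of t T w, unfolded eq] sums] vec.scale_sum_right vec.scale_scale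
    by (intro sum.cong) (simp_all only: mult.commute)
qed

lemma mexp_eigenvector:
  fixes T :: "complex^'n^'n"
  assumes "T *v w = l *s w"
  shows "mexp t T *v w = exp (complex_of_real t * l) *s w"
proof -
  have "((*v) (T - mat l) ^^ 1) w = 0"
    using assms by (simp add: matrix_vector_mult_diff_rdistrib)
  from mexp_generalized_eigenvector[OF this] show ?thesis by simp
qed

lemma mexp_decay:
  fixes T :: "complex^'n^'n"
  assumes "((*v) (T - mat l) ^^ m) w = 0" and "Re l < 0"
  shows "((\<lambda>t. mexp t T *v w) \<longlongrightarrow> 0) at_top"
proof -
  let ?N = "\<lambda>j. ((*v) (T - mat l) ^^ j) w"
  have "((\<lambda>t. t ^ j * exp (t * Re l)) \<longlongrightarrow> 0) at_top" for j
  proof -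
    have "((\<lambda>t. (- Re l * t) ^ j / exp (- Re l * t)) \<longlongrightarrow> 0) at_top"
      using assms(2)
      by (intro filterlim_compose[OF tendsto_power_div_exp_0]
          filterlim_tendsto_pos_mult_at_top[OF tendsto_const _ filterlim_ident]) auto
    then have "((\<lambda>t. (1 / (- Re l) ^ j) * ((- Re l * t) ^ j / exp (- Re l * t))) \<longlongrightarrow> 0) at_top"
      by (rule tendsto_mult_right_zero)
    moreover have "(1 / (- Re l) ^ j) * ((- Re l * t) ^ j / exp (- Re l * t)) = t ^ j * exp (t * Re l)" for t
      unfolding power_mult_distrib using assms(2) by (simp add: exp_minus field_simps)
    ultimately show ?thesis by simp
  qed
  then have "((\<lambda>t. \<Sum>j<m. t ^ j * exp (t * Re l) * (norm (?N j) / fact j)) \<longlongrightarrow> 0) at_top"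
    by (intro tendsto_null_sum tendsto_mult_left_zero)
  then show ?thesis
  proof (rule Lim_null_comparison[rotated])
    show "\<forall>\<^sub>F t in at_top. norm (mexp t T *v w) \<le>
        (\<Sum>j<m. t ^ j * exp (t * Re l) * (norm (?N j) / fact j))"
      using eventually_ge_at_top[of 0]
    proof eventually_elim
      case (elim t)
      have "norm (mexp t T *v w) = exp (t * Re l) *
          norm (\<Sum>j<m. complex_of_real (t ^ j / fact j) *s ?N j)"
        unfolding mexp_generalized_eigenvector[OF assms(1)] norm_smult_vec by simp
      also have "\<dots> \<le> exp (t * Re l) * (\<Sum>j<m. norm (complex_of_real (t ^ j / fact j) *s ?N j))"
        by (intro mult_left_mono norm_sum) simp
      also have "\<dots> = (\<Sum>j<m. t ^ j * exp (t * Re l) * (norm (?N j) / fact j))"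
        unfolding norm_smult_vec norm_of_real sum_distrib_left using elim
        by (intro sum.cong) auto
      finally show ?case .
    qed
  qed
qed

section \<open>Boundedness excludes Jordan blocks\<close>

lemma linear_growth_bounded_zero:
  fixes h :: "'a::real_normed_vector"
  assumes "\<And>k::nat. real k * norm h \<le> C"
  shows "h = 0"
proof (rule ccontr)
  assume "h \<noteq> 0"
  then obtain k where "C < real k * norm h"
    using reals_Archimedean3[of "norm h"] by auto
  with assms[of k] show False by simp
qed

text \<open>Without Jordan chains of length two there are no longer ones: the exponent m can be
  lowered step by step to 1.\<close>

lemma semisimple_from_square:
  fixes T :: "complex^'n^'n"
  assumes "\<And>g. (T - mat l) *v ((T - mat l) *v g) = 0 \<Longrightarrow> (T - mat l) *v g = 0"
    and "((*v) (T - mat l) ^^ m) w = 0"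
  shows "T *v w = l *s w"
proof -
  have "(T - mat l) *v w = 0"
    using assms(2)
  proof (induction m)
    case (Suc m)
    show ?case
    proof (cases m)
      case 0
      with Suc.prems show ?thesis by simp
    next
      case (Suc j)
      have "((*v) (T - mat l) ^^ m) w = 0"
        using Suc.prems assms(1) unfolding Suc funpow.simps o_apply by blast
      then show ?thesis by (rule Suc.IH)
    qed
  qed simp
  then show ?thesis by (simp add: matrix_vector_mult_diff_rdistrib)
qed

text \<open>A chain g, h of length two has the orbit e^(tl) (g + t h), and |e^(tl)| \<ge> 1 for t
  \<ge> 0. Bounded at t = 0, 1, 2, ..., it forces h = 0.\<close>

lemma semisimple_of_bounded_mexp:
  fixes T :: "complex^'n^'n"
  assumes M: "\<And>t f. t \<ge> 0 \<Longrightarrow> norm (mexp t T *v f) \<le> M * norm f"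
    and "Re l \<ge> 0" and "((*v) (T - mat l) ^^ m) w = 0"
  shows "T *v w = l *s w"
proof (rule semisimple_from_square[OF _ assms(3)])
  fix g
  let ?h = "(T - mat l) *v g"
  assume "(T - mat l) *v ?h = 0"
  then have "((*v) (T - mat l) ^^ 2) g = 0" by (simp only: numeral_2_eq_2 funpow.simps o_apply id_apply)
  note formula = mexp_generalized_eigenvector[OF this]
  have "real k * norm ?h \<le> M * norm g + norm g" for k
  proof -
    define x where "x = g + complex_of_real (real k) *s ?h"
    have "mexp (real k) T *v g = exp (complex_of_real (real k) * l) *s x"
      unfolding formula x_def by (simp add: numeral_2_eq_2)
    moreover have "1 \<le> cmod (exp (complex_of_real (real k) * l))"
      using assms(2) by simp
    ultimately have "norm x \<le> M * norm g"
      using M[of "real k" g] mult_right_mono[of 1 _ "norm x"] by fastforce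
    moreover have "norm (complex_of_real (real k) *s ?h) \<le> norm x + norm g"
      unfolding x_def by (metis add.commute add_diff_cancel_left' norm_triangle_ineq4)
    ultimately show ?thesis by simp
  qed
  then show "?h = 0" by (rule linear_growth_bounded_zero)
qed

text \<open>Here a chain g, h gives T^k g = l^k g + k l^(k-1) h with unimodular l, which again grows
  linearly unless h = 0.\<close>

lemma semisimple_of_bounded_mpow:
  fixes T :: "complex^'n^'n"
  assumes M: "\<And>k f. norm (mpow T k *v f) \<le> M * norm f"
    and "cmod l = 1" and "((*v) (T - mat l) ^^ m) w = 0"
  shows "T *v w = l *s w"
proof (rule semisimple_from_square[OF _ assms(3)])
  fix g
  let ?h = "(T - mat l) *v g"
  assume "(T - mat l) *v ?h = 0"
  then have "((*v) (T - mat l) ^^ 2) g = 0" by (simp only: numeral_2_eq_2 funpow.simps o_apply id_apply)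
  note formula = mpow_generalized_eigenvector[OF this]
  have "real k * norm ?h \<le> M * norm g + norm g" for k
  proof -
    have "mpow T k *v g - l ^ k *s g = (of_nat k * l ^ (k - 1)) *s ?h"
      unfolding formula by (simp add: numeral_2_eq_2)
    then have "norm (mpow T k *v g - l ^ k *s g) = real k * norm ?h"
      using assms(2) by (simp add: norm_mult norm_power)
    moreover have "norm (mpow T k *v g - l ^ k *s g) \<le> norm (mpow T k *v g) + norm (l ^ k *s g)"
      by (rule norm_triangle_ineq4)
    ultimately show ?thesis
      using M[of k g] assms(2) by (simp add: norm_power)
  qed
  then show "?h = 0" by (rule linear_growth_bounded_zero)
qed

subsection \<open>Asymptotically positive trigonometric sums\<close>

text \<open>For w \<noteq> 1 the geometric sums stay below 2 / |w - 1|, so their averages vanish in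
  the limit.\<close>

lemma cesaro_power:
  fixes w :: complex
  assumes "cmod w \<le> 1"
  shows "(\<lambda>n. (\<Sum>k<n. w ^ k) / of_nat n) \<longlonglongrightarrow> (if w = 1 then 1 else 0)"
proof (cases "w = 1")
  case True
  have "\<forall>\<^sub>F n in sequentially. (\<Sum>k<n. w ^ k) / of_nat n = 1"
    using eventually_gt_at_top[of 0] by eventually_elim (simp add: True)
  with True show ?thesis by (simp add: tendsto_eventually)
next
  case False
  have "(\<lambda>n. 2 / cmod (w - 1) / real n) \<longlonglongrightarrow> 0"
    by (rule lim_const_over_n)
  then have "(\<lambda>n. (\<Sum>k<n. w ^ k) / of_nat n) \<longlonglongrightarrow> 0"
  proof (rule Lim_null_comparison[rotated], intro always_eventually allI)
    fix n
    show "norm ((\<Sum>k<n. w ^ k) / of_nat n) \<le> 2 / cmod (w - 1) / real n"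
    proof -
      have "(\<Sum>k<n. w ^ k) = (w ^ n - 1) / (w - 1)"
        using geometric_sum[OF False] .
      moreover have "cmod (w ^ n - 1) \<le> 2"
        using norm_triangle_ineq4[of "w ^ n" 1] power_mono[OF assms norm_ge_zero, of n]
        by (simp add: norm_power)
      ultimately show ?thesis
        by (simp only: norm_divide norm_of_nat) (intro divide_right_mono, auto)
    qed
  qed
  with False show ?thesis by simp
qed

text \<open>Averaging against the conjugate powers of \<omega> acts as a filter: the product of z i
  with the conjugate of \<omega> is 1 exactly when z i = \<omega>, and every other term averages to
  0.\<close>

lemma cesaro_coefficient:
  fixes z a :: "'i \<Rightarrow> complex"
  assumes "finite I" and z: "\<And>i. i \<in> I \<Longrightarrow> cmod (z i) \<le> 1" and "cmod \<omega> = 1"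
  shows "(\<lambda>n. (\<Sum>k<n. cnj \<omega> ^ k * (\<Sum>i\<in>I. z i ^ k * a i)) / of_nat n)
    \<longlonglongrightarrow> (\<Sum>i | i \<in> I \<and> z i = \<omega>. a i)"
proof -
  have unit: "cnj \<omega> * x = 1 \<longleftrightarrow> x = \<omega>" for x
  proof -
    have "\<omega> * cnj \<omega> = 1" using assms(3) complex_norm_square[of \<omega>] by simp
    then have "\<omega> * (cnj \<omega> * x) = x" "cnj \<omega> * \<omega> = 1"
      by (simp_all add: mult.commute flip: mult.assoc)
    then show ?thesis by (metis mult.right_neutral)
  qed
  have "(\<lambda>n. \<Sum>i\<in>I. (\<Sum>k<n. (cnj \<omega> * z i) ^ k) / of_nat n * a i)
      \<longlonglongrightarrow> (\<Sum>i\<in>I. (if cnj \<omega> * z i = 1 then 1 else 0) * a i)"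
    using z assms(3) by (intro tendsto_sum tendsto_mult cesaro_power tendsto_const)
      (simp add: norm_mult)
  moreover have "(\<Sum>i\<in>I. (if cnj \<omega> * z i = 1 then 1 else 0) * a i) = (\<Sum>i | i \<in> I \<and> z i = \<omega>. a i)"
    unfolding unit using assms(1) by (auto simp: sum.inter_filter intro!: sum.cong)
  moreover have "(\<Sum>i\<in>I. (\<Sum>k<n. (cnj \<omega> * z i) ^ k) / of_nat n * a i)
      = (\<Sum>k<n. cnj \<omega> ^ k * (\<Sum>i\<in>I. z i ^ k * a i)) / of_nat n" for n
    unfolding sum_distrib_left sum_divide_distrib sum_distrib_right
    by (subst sum.swap) (intro sum.cong, simp_all add: power_mult_distrib)
  ultimately show ?thesis by simp
qed

text \<open>With u_k the trigonometric sum, the coefficient at \<omega> is a limit of rotated means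
  of u_k, so its modulus is at most the limiting mean of |u_k|. By \<open>pos\<close> this mean
  agrees asymptotically with that of Re u_k, which converges to the real part of the coefficient at
  1.\<close>

lemma peripheral_coefficient_bound:
  fixes z a :: "'i \<Rightarrow> complex"
  assumes "finite I" and z: "\<And>i. i \<in> I \<Longrightarrow> cmod (z i) \<le> 1" and "cmod \<omega> = 1"
    and pos: "(\<lambda>k. cmod (\<Sum>i\<in>I. z i ^ k * a i) - Re (\<Sum>i\<in>I. z i ^ k * a i)) \<longlonglongrightarrow> 0"
  shows "cmod (\<Sum>i | i \<in> I \<and> z i = \<omega>. a i) \<le> Re (\<Sum>i | i \<in> I \<and> z i = 1. a i)"
proof (rule field_le_epsilon)
  fix e :: real
  assume "e > 0"
  define u where "u = (\<lambda>k. \<Sum>i\<in>I. z i ^ k * a i)"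
  define d where "d = (\<lambda>k. cmod (u k) - Re (u k))"
  have d0: "d k \<ge> 0" for k
    unfolding d_def using complex_Re_le_cmod[of "u k"] by linarith
  have "d \<longlonglongrightarrow> 0" using pos by (simp add: d_def u_def)
  from LIMSEQ_D[OF this \<open>e > 0\<close>] obtain N where N: "\<And>k. k \<ge> N \<Longrightarrow> d k \<le> e"
    by fastforce
  \<comment> \<open>The finitely many early defects add up to a constant, which averaging turns into
    K / n.\<close>
  define K where "K = (\<Sum>k<N. d k)"
  have dsum: "(\<Sum>k<n. d k) \<le> K + e * real n" for n
  proof -
    have "(\<Sum>k<n. d k) \<le> (\<Sum>k<n. (if k < N then d k else 0) + e)"
      using N d0 \<open>e > 0\<close> by (intro sum_mono) (auto simp: not_less)
    also have "\<dots> = (\<Sum>k | k < n \<and> k < N. d k) + e * real n"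
      by (simp add: sum.distrib flip: sum.inter_filter)
    also have "(\<Sum>k | k < n \<and> k < N. d k) \<le> K"
      unfolding K_def using d0 by (intro sum_mono2) auto
    finally show ?thesis by simp
  qed
  have c: "(\<lambda>n. (\<Sum>k<n. cnj w ^ k * u k) / of_nat n) \<longlonglongrightarrow> (\<Sum>i | i \<in> I \<and> z i = w. a i)"
    if "cmod w = 1" for w
    unfolding u_def using assms(1) z that by (rule cesaro_coefficient)
  have lhs: "(\<lambda>n. cmod ((\<Sum>k<n. cnj \<omega> ^ k * u k) / of_nat n))
      \<longlonglongrightarrow> cmod (\<Sum>i | i \<in> I \<and> z i = \<omega>. a i)"
    by (intro tendsto_norm c assms)
  have "(\<lambda>n. Re ((\<Sum>k<n. u k) / of_nat n)) \<longlonglongrightarrow> Re (\<Sum>i | i \<in> I \<and> z i = 1. a i)"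
    using c[of 1] by (intro tendsto_Re) simp
  then have rhs: "(\<lambda>n. Re ((\<Sum>k<n. u k) / of_nat n) + (K / real n + e))
      \<longlonglongrightarrow> Re (\<Sum>i | i \<in> I \<and> z i = 1. a i) + (0 + e)"
    by (intro tendsto_add tendsto_const lim_const_over_n)
  have "cmod ((\<Sum>k<n. cnj \<omega> ^ k * u k) / of_nat n) \<le> Re ((\<Sum>k<n. u k) / of_nat n) + (K / real n + e)"
    if "n \<ge> 1" for n
  proof -
    have "cmod (\<Sum>k<n. cnj \<omega> ^ k * u k) \<le> (\<Sum>k<n. cmod (u k))"
      using assms(3) by (intro sum_norm_le) (simp add: norm_mult norm_power)
    also have "\<dots> = Re (\<Sum>k<n. u k) + (\<Sum>k<n. d k)"
      by (simp add: d_def sum_subtractf)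
    also have "\<dots> \<le> Re (\<Sum>k<n. u k) + (K + e * real n)"
      using dsum by simp
    finally have "cmod (\<Sum>k<n. cnj \<omega> ^ k * u k) / real n \<le> (Re (\<Sum>k<n. u k) + (K + e * real n)) / real n"
      by (rule divide_right_mono) simp
    also have "\<dots> = Re (\<Sum>k<n. u k) / real n + (K / real n + e)"
      using that by (simp add: add_divide_distrib)
    finally show ?thesis
      by (simp only: norm_divide norm_of_nat Re_divide_of_nat)
  qed
  then show "cmod (\<Sum>i | i \<in> I \<and> z i = \<omega>. a i) \<le> Re (\<Sum>i | i \<in> I \<and> z i = 1. a i) + e"
    using LIMSEQ_le[OF lhs rhs] by auto
qed

section \<open>The positive cone and the distance to it\<close>

lemma zero_in_pos_cone [simp]: "0 \<in> pos_cone"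
  by (simp add: pos_cone_def)

lemma axis_in_pos_cone [simp]: "axis j 1 \<in> pos_cone"
  by (simp add: pos_cone_def axis_def)

lemma in_pos_cone_iff: "f \<in> pos_cone \<longleftrightarrow> (\<forall>i. Im (f $ i) = 0 \<and> 0 \<le> Re (f $ i))"
  by (auto simp: pos_cone_def complex_is_Real_iff)

lemma closed_pos_cone: "closed (pos_cone :: (complex^'n) set)"
proof -
  have "pos_cone = (\<Inter>i. {f::complex^'n. Im (f $ i) = 0} \<inter> {f. 0 \<le> Re (f $ i)})"
    by (auto simp: in_pos_cone_iff)
  also have "closed \<dots>"
    by (intro closed_INT ballI closed_Int closed_Collect_eq closed_Collect_le continuous_intros)
  finally show ?thesis .
qed

lemma d_plus_eq_0_iff: "d_plus f = 0 \<longleftrightarrow> f \<in> pos_cone"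
  unfolding d_plus_def using in_closed_iff_infdist_zero[OF closed_pos_cone, of f] zero_in_pos_cone
  by blast

lemma d_plus_nonneg: "d_plus f \<ge> 0"
  by (simp add: d_plus_def infdist_nonneg)

lemma d_plus_triangle: "d_plus f \<le> d_plus g + norm (f - g)"
  unfolding d_plus_def using infdist_triangle[of f pos_cone g] by (simp add: dist_norm)

text \<open>Since \<open>d_plus\<close> is 1-Lipschitz, an orbit may be replaced by its asymptotic
  part.\<close>

lemma d_plus_tendsto_iff:
  assumes "((\<lambda>t. f t - g t) \<longlongrightarrow> 0) F"
  shows "((\<lambda>t. d_plus (f t)) \<longlongrightarrow> 0) F \<longleftrightarrow> ((\<lambda>t. d_plus (g t)) \<longlongrightarrow> 0) F"
proof -
  have *: "((\<lambda>t. d_plus (v t)) \<longlongrightarrow> 0) F"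
    if "((\<lambda>t. d_plus (u t)) \<longlongrightarrow> 0) F" "((\<lambda>t. norm (u t - v t)) \<longlongrightarrow> 0) F" for u v :: "'a \<Rightarrow> complex^'b"
  proof (rule Lim_null_comparison)
    show "((\<lambda>t. d_plus (u t) + norm (u t - v t)) \<longlongrightarrow> 0) F"
      using tendsto_add[OF that] by simp
    show "\<forall>\<^sub>F t in F. norm (d_plus (v t)) \<le> d_plus (u t) + norm (u t - v t)"
    proof (intro always_eventually allI)
      show "norm (d_plus (v t)) \<le> d_plus (u t) + norm (u t - v t)" for t
        using d_plus_triangle[of "v t" "u t"] d_plus_nonneg[of "v t"]
        by (simp add: norm_minus_commute)
    qed
  qed
  have "((\<lambda>t. norm (f t - g t)) \<longlongrightarrow> 0) F" "((\<lambda>t. norm (g t - f t)) \<longlongrightarrow> 0) F"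
    using tendsto_norm_zero[OF assms] by (simp_all add: norm_minus_commute)
  with * show ?thesis by blast
qed

text \<open>The function |x| - Re x is 2-Lipschitz and vanishes on nonnegative reals; compare f with
  a nearest point of the cone.\<close>

lemma norm_minus_Re_le_d_plus: "cmod (f $ i) - Re (f $ i) \<le> 2 * d_plus f"
proof -
  obtain p where p: "p \<in> pos_cone" "d_plus f = dist f p"
    unfolding d_plus_def using infdist_attains_inf[OF closed_pos_cone] zero_in_pos_cone by blast
  have "cmod (p $ i) = Re (p $ i)"
    using p(1) by (simp add: in_pos_cone_iff cmod_eq_Re)
  moreover have "cmod (f $ i) \<le> cmod (p $ i) + cmod (f $ i - p $ i)"
    by (metis add.commute diff_add_cancel norm_triangle_ineq)
  moreover have "Re (p $ i) \<le> Re (f $ i) + cmod (f $ i - p $ i)"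
    using abs_Re_le_cmod[of "f $ i - p $ i"] by simp
  moreover have "cmod (f $ i - p $ i) \<le> d_plus f"
    using Finite_Cartesian_Product.norm_nth_le[of "f - p" i] p(2) by (simp add: dist_norm)
  ultimately show ?thesis by simp
qed

text \<open>The weak Perron-Frobenius theorem, read coordinatewise. If no \<open>z i\<close> is 1,
  the right-hand sum is empty and all unimodular coefficients vanish; this is how the value 1 is
  forced to occur.\<close>

lemma asymptotically_positive_peripheral_bound:
  fixes a :: "'i \<Rightarrow> complex^'n"
  assumes "finite I" and "\<And>i. i \<in> I \<Longrightarrow> cmod (z i) \<le> 1" and "cmod \<omega> = 1"
    and "(\<lambda>k. d_plus (\<Sum>i\<in>I. z i ^ k *s a i)) \<longlonglongrightarrow> 0"
  shows "cmod ((\<Sum>i | i \<in> I \<and> z i = \<omega>. a i) $ j) \<le> Re ((\<Sum>i | i \<in> I \<and> z i = 1. a i) $ j)"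
proof -
  have "(\<lambda>k. cmod (\<Sum>i\<in>I. z i ^ k * a i $ j) - Re (\<Sum>i\<in>I. z i ^ k * a i $ j)) \<longlonglongrightarrow> 0"
  proof (rule Lim_null_comparison)
    show "(\<lambda>k. 2 * d_plus (\<Sum>i\<in>I. z i ^ k *s a i)) \<longlonglongrightarrow> 0"
      using assms(4) by (rule tendsto_mult_right_zero)
    have "norm (cmod (\<Sum>i\<in>I. z i ^ k * a i $ j) - Re (\<Sum>i\<in>I. z i ^ k * a i $ j))
        \<le> 2 * d_plus (\<Sum>i\<in>I. z i ^ k *s a i)" for k
      using norm_minus_Re_le_d_plus[of "\<Sum>i\<in>I. z i ^ k *s a i" j]
        complex_Re_le_cmod[of "\<Sum>i\<in>I. z i ^ k * a i $ j"] by simp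
    then show "\<forall>\<^sub>F k in sequentially. norm (cmod (\<Sum>i\<in>I. z i ^ k * a i $ j)
        - Re (\<Sum>i\<in>I. z i ^ k * a i $ j)) \<le> 2 * d_plus (\<Sum>i\<in>I. z i ^ k *s a i)"
      by simp
  qed
  from peripheral_coefficient_bound[OF assms(1-3) this] show ?thesis by simp
qed

section \<open>Positivity and power boundedness tested on unit vectors\<close>

lemma vec_eq_sum_axis: "(f::complex^'n) = (\<Sum>j\<in>UNIV. f $ j *s axis j 1)"
  by (metis basis_expansion)

lemma mult_vec_eq_sum: "(T::complex^'n^'n) *v f = (\<Sum>j\<in>UNIV. f $ j *s (T *v axis j 1))"
proof -
  have "T *v f = T *v (\<Sum>j\<in>UNIV. f $ j *s axis j 1)"
    by (simp flip: vec_eq_sum_axis)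
  also have "\<dots> = (\<Sum>j\<in>UNIV. f $ j *s (T *v axis j 1))"
    by (simp add: vec.linear_sum[OF matrix_vector_mul_linear_gen] vector_scalar_commute)
  finally show ?thesis .
qed

lemma mult_vec_in_pos_cone:
  fixes T :: "complex^'n^'n"
  assumes "\<And>j. T *v axis j 1 \<in> pos_cone" and "f \<in> pos_cone"
  shows "T *v f \<in> pos_cone"
proof -
  have "Im (f $ j * (T *v axis j 1) $ i) = 0 \<and> 0 \<le> Re (f $ j * (T *v axis j 1) $ i)" for i j
    using assms by (simp add: in_pos_cone_iff)
  then show ?thesis
    unfolding mult_vec_eq_sum[of T f] by (simp add: in_pos_cone_iff sum_nonneg)
qed

lemma power_bounded_of_convergent:
  fixes T :: "complex^'n^'n"
  assumes "\<And>f. convergent (\<lambda>k. mpow T k *v f)"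
  shows "power_bounded T"
proof -
  have "\<exists>B. \<forall>k. norm (mpow T k *v axis j 1) \<le> B" for j
    using convergent_imp_Bseq[OF assms[of "axis j 1"]] by (auto simp: Bseq_def)
  then obtain B where B: "\<And>j k. norm (mpow T k *v axis j 1) \<le> B j" by metis
  have "norm (mpow T k *v f) \<le> (\<Sum>j\<in>UNIV. B j) * norm f" for k f
  proof -
    have "norm (mpow T k *v f) \<le> (\<Sum>j\<in>UNIV. norm (f $ j *s (mpow T k *v axis j 1)))"
      unfolding mult_vec_eq_sum[of _ f] by (rule norm_sum)
    also have "\<dots> \<le> (\<Sum>j\<in>UNIV. norm f * B j)"
      using B by (intro sum_mono) (auto intro!: mult_mono Finite_Cartesian_Product.norm_nth_le)
    also have "\<dots> = (\<Sum>j\<in>UNIV. B j) * norm f"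
      by (simp add: sum_distrib_left mult.commute)
    finally show ?thesis .
  qed
  then show ?thesis unfolding power_bounded_def by blast
qed

subsection \<open>Peripheral spectrum\<close>

lemma spectrum_add_mat: "spectrum_mat (A + mat c) = (\<lambda>l. l + c) ` spectrum_mat A"
proof -
  have "(A + mat c) *v v = l *s v \<longleftrightarrow> A *v v = (l - c) *s v" for l v
    by (auto simp: matrix_vector_mult_add_rdistrib vec.scale_left_diff_distrib eq_diff_eq)
  then have "l \<in> spectrum_mat (A + mat c) \<longleftrightarrow> l - c \<in> spectrum_mat A" for l
    by (simp add: spectrum_mat_def)
  then show ?thesis by (force simp: image_iff)
qed

lemma funpow_scaleR_mult_vec:
  fixes T :: "complex^'n^'n"
  shows "((*v) (a *\<^sub>R T) ^^ k) w = a ^ k *\<^sub>R ((*v) T ^^ k) w"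
proof (induction k)
  case (Suc k)
  have "((*v) (a *\<^sub>R T) ^^ Suc k) w = a *\<^sub>R (T *v (a ^ k *\<^sub>R ((*v) T ^^ k) w))"
    by (simp only: funpow.simps o_apply Suc scaleR_mult_vec)
  also have "\<dots> = a ^ Suc k *\<^sub>R ((*v) T ^^ Suc k) w"
    by (simp only: funpow.simps o_apply linear_cmul[OF matrix_vector_mul_linear] scaleR_scaleR power_Suc)
  finally show ?case .
qed simp

text \<open>Simultaneous Dirichlet approximation brings all t Im l / (2 pi) within 1/N of integers;
  each exponential is then off 1 by less than 2 pi / N, and N is chosen to make this less than
  e.\<close>

lemma exp_recurrence:
  fixes L :: "complex set"
  assumes "finite L" and im: "\<And>l. l \<in> L \<Longrightarrow> Re l = 0" and "e > 0"
  shows "\<exists>t\<ge>a. \<forall>l\<in>L. cmod (exp (complex_of_real t * l) - 1) < e"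
proof -
  obtain n and f :: "nat \<Rightarrow> complex" where L: "L = f ` {i. i < n}"
    using finite_imp_nat_seg_image_inj_on[OF assms(1)] by auto
  obtain N :: nat where N: "2 * pi / e < real N" using reals_Archimedean2 by blast
  have "0 < 2 * pi / e" using assms(3) by simp
  with N have N0: "real N > 0" by linarith
  \<comment> \<open>Dirichlet's theorem yields only some q \<ge> 1; scaling the frequencies by K
    beforehand makes t = q K at least \<open>a\<close>.\<close>
  define K where "K = max a 1"
  obtain q p where q: "q > 0"
      "\<And>i. i < n \<Longrightarrow> \<bar>of_int q * (K * Im (f i) / (2 * pi)) - of_int (p i)\<bar> < 1 / real N"
    using Dirichlet_approx_simult[of N n "\<lambda>i. K * Im (f i) / (2 * pi)"] N0
    unfolding of_nat_0_less_iff times_divide_eq_right by blast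
  define t where "t = of_int q * K"
  have "1 * K \<le> of_int q * K"
    using q(1) by (intro mult_right_mono) (auto simp: K_def)
  then have "t \<ge> a" by (simp add: t_def K_def)
  moreover have "cmod (exp (complex_of_real t * f i) - 1) < e" if i: "i < n" for i
  proof -
    define x where "x = 2 * pi * (of_int q * (K * Im (f i) / (2 * pi)) - of_int (p i))"
    \<comment> \<open>Full turns drop out, leaving the angle x, and |e^(ix) - 1| = 2 |sin (x/2)|
      \<le> |x|.\<close>
    have "complex_of_real t * f i = \<i> * complex_of_real x + of_int (p i) * (of_real (2 * pi) * \<i>)"
      using im[of "f i"] i L by (auto simp: complex_eq_iff t_def x_def algebra_simps)
    then have "exp (complex_of_real t * f i) = exp (\<i> * complex_of_real x)"
      by (simp add: exp_add exp_eq_1 mult_ac)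
    then have "cmod (exp (complex_of_real t * f i) - 1) = 2 * \<bar>sin (x / 2)\<bar>"
      by (simp add: dist_exp_i_1)
    also have "\<dots> \<le> \<bar>x\<bar>"
      using abs_sin_x_le_abs_x[of "x / 2"] by simp
    also have "\<bar>x\<bar> < 2 * pi * (1 / real N)"
      unfolding x_def abs_mult using mult_strict_left_mono[OF q(2)[OF i], of "2 * pi"] by simp
    also have "\<dots> < e"
      using N N0 assms(3) by (simp add: field_simps)
    finally show ?thesis .
  qed
  ultimately show ?thesis using L by auto
qed

section \<open>Spectral projections on eigenvectors and the spectral bound\<close>

lemma spectral_family_spectrum:
  assumes "spectral_family A E m"
  shows "finite (spectrum_mat A)" and "spectrum_mat A \<noteq> {}"
proof -
  show "finite (spectrum_mat A)" using assms by (simp add: spectral_family_def)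
  have "(\<Sum>l\<in>spectrum_mat A. E l *v axis undefined 1) = axis undefined 1"
    using assms by (simp add: spectral_family_def)
  then show "spectrum_mat A \<noteq> {}" by (auto simp: axis_eq_0_iff)
qed

text \<open>All \<open>E k\<close> with k \<noteq> c kill v, so the resolution of the identity
  leaves v to \<open>E c\<close>.\<close>

lemma spectral_family_eigenvector:
  assumes "spectral_family A E m" and "A *v v = c *s v" and "c \<in> spectrum_mat A" and "l \<in> spectrum_mat A"
  shows "E l *v v = (if l = c then v else 0)"
proof -
  have zero: "E k *v v = 0" if "k \<in> spectrum_mat A" "k \<noteq> c" for k
    using commuting_eigenvector_zero[OF assms(2), where E = "E k" and l = k and m = "m k"] assms(1) that
    unfolding spectral_family_def by metis
  have "v = (\<Sum>k\<in>spectrum_mat A. E k *v v)"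
    using assms(1) by (simp add: spectral_family_def)
  also have "\<dots> = E c *v v + (\<Sum>k\<in>spectrum_mat A - {c}. E k *v v)"
    using assms(1,3) by (intro sum.remove) (simp_all add: spectral_family_def)
  also have "(\<Sum>k\<in>spectrum_mat A - {c}. E k *v v) = 0"
    using zero by (intro sum.neutral) auto
  finally show ?thesis using zero assms(4) by auto
qed

lemma spectral_family_nonzero:
  assumes "spectral_family A E m" and "l \<in> spectrum_mat A"
  shows "\<exists>j. E l *v axis j 1 \<noteq> 0"
proof (rule ccontr)
  assume *: "\<not> ?thesis"
  obtain v where v: "v \<noteq> 0" "A *v v = l *s v"
    using assms(2) by (auto simp: spectrum_mat_def)
  have "E l *v v = 0" using * unfolding mult_vec_eq_sum[of _ v] by simp
  with spectral_family_eigenvector[OF assms(1) v(2) assms(2) assms(2)] v(1) show False by simp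
qed

lemma spectral_bound_ge:
  assumes "spectral_family A E m" and "l \<in> spectrum_mat A"
  shows "Re l \<le> spectral_bound A"
  using assms spectral_family_spectrum[OF assms(1)] by (simp add: spectral_bound_def)

lemma spectral_bound_attained:
  assumes "spectral_family A E m"
  shows "\<exists>l\<in>spectrum_mat A. Re l = spectral_bound A"
proof -
  have "spectral_bound A \<in> Re ` spectrum_mat A"
    unfolding spectral_bound_def using spectral_family_spectrum[OF assms] by (intro Max_in) auto
  then show ?thesis by auto
qed

section \<open>The peripheral part of the orbits\<close>

definition peripheral_spectrum :: "complex^'n^'n \<Rightarrow> complex set" where
  "peripheral_spectrum A = {l \<in> spectrum_mat A. Re l = spectral_bound A}"

text \<open>The almost periodic part S_t of the rescaled semigroup. All exponents are imaginary, so
  negative t make sense too; S_0 is the sum of the peripheral projections.\<close>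

definition peripheral_orbit ::
    "complex^'n^'n \<Rightarrow> (complex \<Rightarrow> complex^'n^'n) \<Rightarrow> real \<Rightarrow> complex^'n \<Rightarrow> complex^'n" where
  "peripheral_orbit A E t f =
    (\<Sum>l\<in>peripheral_spectrum A. exp (complex_of_real t * (l - spectral_bound A)) *s (E l *v f))"

lemma finite_peripheral_spectrum:
  "spectral_family A E m \<Longrightarrow> finite (peripheral_spectrum A)"
  by (simp add: peripheral_spectrum_def spectral_family_spectrum)

lemma peripheral_eigenvector:
  fixes A :: "complex^'n^'n"
  assumes "spectral_family A E m" and "semigroup_bounded A" and "l \<in> peripheral_spectrum A"
  shows "A *v (E l *v f) = l *s (E l *v f)"
proof -
  let ?s = "complex_of_real (spectral_bound A)"
  obtain M where M: "\<And>t f. t \<ge> 0 \<Longrightarrow> norm (mexp t (A - mat ?s) *v f) \<le> M * norm f"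
    using assms(2) unfolding semigroup_bounded_def by blast
  have shift: "A - mat ?s - mat (l - ?s) = A - mat l"
    by (simp add: vec_eq_iff mat_def)
  have "(A - mat ?s) *v (E l *v f) = (l - ?s) *s (E l *v f)"
  proof (rule semisimple_of_bounded_mexp[OF M])
    show "((*v) (A - mat ?s - mat (l - ?s)) ^^ m l) (E l *v f) = 0"
      unfolding shift using assms(1,3) by (simp add: spectral_family_def peripheral_spectrum_def)
  qed (use assms(3) in \<open>simp_all add: peripheral_spectrum_def\<close>)
  then show ?thesis
    by (simp add: matrix_vector_mult_diff_rdistrib vec.scale_left_diff_distrib)
qed

lemma mexp_peripheral_asymptotics:
  fixes A :: "complex^'n^'n"
  assumes "spectral_family A E m" and "semigroup_bounded A"
  shows "((\<lambda>t. mexp t (A - mat (complex_of_real (spectral_bound A))) *v f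
    - peripheral_orbit A E t f) \<longlongrightarrow> 0) at_top"
proof -
  let ?s = "complex_of_real (spectral_bound A)"
  let ?S = "spectrum_mat A" and ?P = "peripheral_spectrum A"
  have shift: "A - mat ?s - mat (l - ?s) = A - mat l" for l
    by (simp add: vec_eq_iff mat_def)
  have PS: "?P \<subseteq> ?S" by (auto simp: peripheral_spectrum_def)
  have "((\<lambda>t. mexp t (A - mat ?s) *v (E l *v f)) \<longlongrightarrow> 0) at_top" if "l \<in> ?S - ?P" for l
  proof (rule mexp_decay)
    show "((*v) (A - mat ?s - mat (l - ?s)) ^^ m l) (E l *v f) = 0"
      unfolding shift using assms(1) that by (simp add: spectral_family_def)
    show "Re (l - ?s) < 0"
      using that spectral_bound_ge[OF assms(1), of l] by (auto simp: peripheral_spectrum_def)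
  qed
  then have "((\<lambda>t. \<Sum>l\<in>?S - ?P. mexp t (A - mat ?s) *v (E l *v f)) \<longlongrightarrow> 0) at_top"
    by (intro tendsto_null_sum)
  moreover have "mexp t (A - mat ?s) *v f - peripheral_orbit A E t f =
      (\<Sum>l\<in>?S - ?P. mexp t (A - mat ?s) *v (E l *v f))" for t
  proof -
    have "mexp t (A - mat ?s) *v (E l *v f) = exp (complex_of_real t * (l - ?s)) *s (E l *v f)"
      if "l \<in> ?P" for l
      using peripheral_eigenvector[OF assms that]
      by (intro mexp_eigenvector) (simp add: matrix_vector_mult_diff_rdistrib vec.scale_left_diff_distrib)
    then have "(\<Sum>l\<in>?P. mexp t (A - mat ?s) *v (E l *v f)) = peripheral_orbit A E t f"
      by (simp add: peripheral_orbit_def)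
    moreover have "mexp t (A - mat ?s) *v f = (\<Sum>l\<in>?S. mexp t (A - mat ?s) *v (E l *v f))"
      using assms(1) by (simp add: spectral_family_def flip: vec.linear_sum[OF matrix_vector_mul_linear_gen])
    ultimately show ?thesis
      using sum.subset_diff[OF PS spectral_family_spectrum(1)[OF assms(1)],
          of "\<lambda>l. mexp t (A - mat ?s) *v (E l *v f)"] by simp
  qed
  ultimately show ?thesis by simp
qed

text \<open>Eigenvalues outside \<open>I\<close> land in the open unit disc and decay.
  \<open>I\<close> is left free: it is the dominant point alone in one direction of the theorem and
  the set of all unimodular points in the other.\<close>

lemma mpow_peripheral_asymptotics:
  fixes A :: "complex^'n^'n"
  assumes "spectral_family A E m"
    and "\<And>l. l \<in> spectrum_mat A - I \<Longrightarrow> cmod (complex_of_real a * (l + c)) < 1"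
    and "I \<subseteq> spectrum_mat A" and "\<And>l. l \<in> I \<Longrightarrow> A *v (E l *v f) = l *s (E l *v f)"
  shows "(\<lambda>k. mpow (a *\<^sub>R (A + mat c)) k *v f
    - (\<Sum>l\<in>I. (complex_of_real a * (l + c)) ^ k *s (E l *v f))) \<longlonglongrightarrow> 0"
proof -
  let ?S = "spectrum_mat A" and ?T = "a *\<^sub>R (A + mat c)"
  let ?z = "\<lambda>l. complex_of_real a * (l + c)"
  have shift: "?T - mat (?z l) = a *\<^sub>R (A - mat l)" for l
    by (simp add: vec_eq_iff mat_def) (simp add: scaleR_conv_of_real algebra_simps)
  have "(\<lambda>k. mpow ?T k *v (E l *v f)) \<longlonglongrightarrow> 0" if "l \<in> ?S - I" for l
  proof (rule mpow_decay[OF _ assms(2)[OF that]])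
    show "((*v) (?T - mat (?z l)) ^^ m l) (E l *v f) = 0"
      unfolding shift funpow_scaleR_mult_vec using assms(1) that by (simp add: spectral_family_def)
  qed
  then have "(\<lambda>k. \<Sum>l\<in>?S - I. mpow ?T k *v (E l *v f)) \<longlonglongrightarrow> 0"
    by (intro tendsto_null_sum)
  moreover have "mpow ?T k *v f - (\<Sum>l\<in>I. ?z l ^ k *s (E l *v f)) =
      (\<Sum>l\<in>?S - I. mpow ?T k *v (E l *v f))" for k
  proof -
    have "mpow ?T k *v (E l *v f) = ?z l ^ k *s (E l *v f)" if "l \<in> I" for l
      unfolding mpow_mult_vec
    proof (rule funpow_eigenvector)
      show "?T *v (E l *v f) = ?z l *s (E l *v f)"
        using assms(4)[OF that]
        by (simp add: matrix_vector_mult_add_rdistrib scaleR_eq_smult vec.scale_left_distrib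
            vec.scale_right_distrib distrib_left)
    qed
    then have "(\<Sum>l\<in>I. mpow ?T k *v (E l *v f)) = (\<Sum>l\<in>I. ?z l ^ k *s (E l *v f))" by simp
    moreover have "mpow ?T k *v f = (\<Sum>l\<in>?S. mpow ?T k *v (E l *v f))"
      using assms(1) by (simp add: spectral_family_def flip: vec.linear_sum[OF matrix_vector_mul_linear_gen])
    ultimately show ?thesis
      using sum.subset_diff[OF assms(3) spectral_family_spectrum(1)[OF assms(1)],
          of "\<lambda>l. mpow ?T k *v (E l *v f)"] by simp
  qed
  ultimately show ?thesis by simp
qed

text \<open>Recurrence gives arbitrarily late times t + u at which the orbit is close to its value
  at t, while its distance to the cone tends to 0. So the distance at t is below every e >
  0.\<close>

lemma peripheral_orbit_in_pos_cone:
  fixes A :: "complex^'n^'n"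
  assumes "spectral_family A E m" and "semigroup_bounded A" and "semigroup_asymp_pos A"
    and f: "f \<in> pos_cone"
  shows "peripheral_orbit A E t f \<in> pos_cone"
proof -
  let ?s = "complex_of_real (spectral_bound A)" and ?P = "peripheral_spectrum A"
  let ?g = "\<lambda>t. peripheral_orbit A E t f"
  have "((\<lambda>t. d_plus (?g t)) \<longlongrightarrow> 0) at_top"
    using assms(3) f d_plus_tendsto_iff[OF mexp_peripheral_asymptotics[OF assms(1,2)], of f]
    unfolding semigroup_asymp_pos_def by blast
  have "d_plus (?g t) \<le> 0 + e" if "e > 0" for e
  proof -
    have "\<forall>\<^sub>F t in at_top. d_plus (?g t) < e / 2"
      using \<open>e > 0\<close> \<open>((\<lambda>t. d_plus (?g t)) \<longlongrightarrow> 0) at_top\<close> by (intro order_tendstoD) auto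
    then obtain a where a: "\<And>u. u \<ge> a \<Longrightarrow> d_plus (?g u) < e / 2"
      by (auto simp: eventually_at_top_linorder)
    define C where "C = (\<Sum>l\<in>?P. norm (E l *v f))"
    have C: "C \<ge> 0" unfolding C_def by (intro sum_nonneg) simp
    \<comment> \<open>Makes d C at most e / 2; adding 1 guards against C = 0.\<close>
    define d where "d = e / 2 / (C + 1)"
    have d: "d > 0" using \<open>e > 0\<close> C by (simp add: d_def)
    have fin: "finite ((\<lambda>l. l - ?s) ` ?P)"
      using finite_peripheral_spectrum[OF assms(1)] by simp
    have re: "Re x = 0" if "x \<in> (\<lambda>l. l - ?s) ` ?P" for x
      using that by (auto simp: peripheral_spectrum_def)
    obtain u where u: "u \<ge> a - t" "\<And>l. l \<in> ?P \<Longrightarrow> cmod (exp (complex_of_real u * (l - ?s)) - 1) < d"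
      using exp_recurrence[OF fin re d, of "a - t"] by blast
    have "?g t - ?g (t + u) = (\<Sum>l\<in>?P. (exp (complex_of_real t * (l - ?s)) *
        (1 - exp (complex_of_real u * (l - ?s)))) *s (E l *v f))"
      unfolding peripheral_orbit_def sum_subtractf[symmetric]
      by (intro sum.cong refl) (simp only: of_real_add distrib_right[of "complex_of_real t"] exp_add
          right_diff_distrib[of "exp _"] mult_1_right vec.scale_left_diff_distrib)
    then have "norm (?g t - ?g (t + u)) \<le> (\<Sum>l\<in>?P. norm ((exp (complex_of_real t * (l - ?s)) *
        (1 - exp (complex_of_real u * (l - ?s)))) *s (E l *v f)))"
      by (simp only: norm_sum)
    also have "\<dots> \<le> (\<Sum>l\<in>?P. d * norm (E l *v f))"
    proof (rule sum_mono)
      fix l assume l: "l \<in> ?P"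
      have unit: "cmod (exp (complex_of_real t * (l - ?s))) = 1"
        using l by (simp add: peripheral_spectrum_def)
      show "norm ((exp (complex_of_real t * (l - ?s)) *
          (1 - exp (complex_of_real u * (l - ?s)))) *s (E l *v f)) \<le> d * norm (E l *v f)"
        unfolding norm_smult_vec norm_mult unit using u(2)[OF l]
        by (intro mult_right_mono) (simp_all add: norm_minus_commute)
    qed
    also have "\<dots> = d * C" by (simp add: C_def sum_distrib_left)
    also have "\<dots> \<le> d * (C + 1)" using d by simp
    also have "\<dots> = e / 2" unfolding d_def using C by (intro nonzero_eq_divide_eq[THEN iffD1]) simp_all
    finally have "norm (?g t - ?g (t + u)) \<le> e / 2" .
    moreover have "d_plus (?g (t + u)) < e / 2" using a u(1) by simp
    ultimately show ?thesis using d_plus_triangle[of "?g t" "?g (t + u)"] by simp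
  qed
  then have "d_plus (?g t) \<le> 0" by (rule field_le_epsilon)
  then show ?thesis using d_plus_nonneg[of "?g t"] by (simp flip: d_plus_eq_0_iff)
qed

text \<open>Each matrix entry is nonnegative on some right neighbourhood of 0, and finitely many of
  these can be intersected, also with one on which the exponential of l differs from 1.\<close>

lemma peripheral_orbit_small_time:
  fixes A :: "complex^'n^'n"
  assumes "spectral_family A E m" and "semigroup_bounded A" and "semigroup_asymp_pos A"
    and l: "l \<in> peripheral_spectrum A" "l \<noteq> spectral_bound A"
  shows "\<exists>t. exp (complex_of_real t * (l - spectral_bound A)) \<noteq> 1 \<and>
    (\<forall>j. 2 *\<^sub>R peripheral_orbit A E t (axis j 1) - peripheral_orbit A E 0 (axis j 1) \<in> pos_cone)"
proof -
  let ?g = "\<lambda>t j. peripheral_orbit A E t (axis j 1)"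
  have g: "Im (?g t j $ i) = 0" "0 \<le> Re (?g t j $ i)" for t i j
    using peripheral_orbit_in_pos_cone[OF assms(1-3) axis_in_pos_cone, of t j]
    by (auto simp: in_pos_cone_iff)
  have "\<forall>\<^sub>F t in at_right 0. 0 \<le> Re ((2 *\<^sub>R ?g t j - ?g 0 j) $ i)" for i j
  proof (cases "Re (?g 0 j $ i) = 0")
    case True
    then show ?thesis using g(2)[of _ j i] by (simp add: True)
  next
    case False
    then have pos: "0 < Re (?g 0 j $ i)" using g(2)[of 0 j i] by simp
    have "((\<lambda>t. Re ((2 *\<^sub>R ?g t j - ?g 0 j) $ i)) \<longlongrightarrow> 2 * Re (?g 0 j $ i) - Re (?g 0 j $ i)) (at_right 0)"
      unfolding peripheral_orbit_def by (auto intro!: tendsto_eq_intros)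
    with pos have "\<forall>\<^sub>F t in at_right 0. 0 < Re ((2 *\<^sub>R ?g t j - ?g 0 j) $ i)"
      by (intro order_tendstoD) auto
    then show ?thesis by eventually_elim simp
  qed
  then have "\<forall>\<^sub>F t in at_right 0. \<forall>j\<in>UNIV. \<forall>i\<in>UNIV. 0 \<le> Re ((2 *\<^sub>R ?g t j - ?g 0 j) $ i)"
    by (intro eventually_ball_finite ballI) auto
  moreover have "\<forall>\<^sub>F t in at_right 0. exp (complex_of_real t * (l - spectral_bound A)) \<noteq> 1"
  proof -
    have im: "Im l \<noteq> 0" "Re l = spectral_bound A"
      using l by (auto simp: peripheral_spectrum_def complex_eq_iff)
    \<comment> \<open>Less than one full turn of e^(i t Im l), so the exponential has not returned
      to 1.\<close>
    have "\<forall>\<^sub>F t in at_right 0. t \<in> {0<..<2 * pi / \<bar>Im l\<bar>}"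
      using im by (intro eventually_at_right_real) simp
    then show ?thesis
    proof eventually_elim
      case (elim t)
      then have t: "t > 0" "\<bar>t * Im l\<bar> < 2 * pi"
        using im by (auto simp: abs_mult pos_less_divide_eq)
      show ?case
      proof
        assume "exp (complex_of_real t * (l - spectral_bound A)) = 1"
        then obtain n :: int where n: "t * Im l = of_int (2 * n) * pi"
          by (auto simp: exp_eq_1)
        then have "\<bar>of_int n\<bar> * (2 * pi) < 1 * (2 * pi)"
          using t(2) by (simp add: abs_mult)
        then have "n = 0" by (simp del: mult_1 add: mult_less_cancel_right)
        with n t(1) im show False by simp
      qed
    qed
  qed
  ultimately have "\<forall>\<^sub>F t in at_right 0. exp (complex_of_real t * (l - spectral_bound A)) \<noteq> 1 \<and>
      (\<forall>j\<in>UNIV. \<forall>i\<in>UNIV. 0 \<le> Re ((2 *\<^sub>R ?g t j - ?g 0 j) $ i))"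
    by eventually_elim simp
  then obtain t where "exp (complex_of_real t * (l - spectral_bound A)) \<noteq> 1"
      "\<And>i j. 0 \<le> Re ((2 *\<^sub>R ?g t j - ?g 0 j) $ i)"
    using eventually_happens'[OF trivial_limit_at_right_real] by blast
  moreover have "Im ((2 *\<^sub>R ?g t j - ?g 0 j) $ i) = 0" for t i j
    using g(1) by simp
  ultimately show ?thesis unfolding in_pos_cone_iff by blast
qed

text \<open>For unimodular w the square of the left side is 5 - 4 Re w, and Re w < 1 unless w =
  1.\<close>

lemma cmod_two_unit_minus_one:
  assumes "cmod w = 1" and "w \<noteq> 1"
  shows "cmod (2 * w - 1) > 1"
proof -
  have sq: "(Re w)\<^sup>2 + (Im w)\<^sup>2 = 1"
    using assms(1) by (simp add: cmod_def)
  have "Re w \<noteq> 1"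
    using sq assms(2) by (auto simp: complex_eq_iff)
  moreover have "Re w \<le> 1" using complex_Re_le_cmod[of w] assms(1) by simp
  ultimately have "Re w < 1" by simp
  have "(cmod (2 * w - 1))\<^sup>2 = 4 * ((Re w)\<^sup>2 + (Im w)\<^sup>2) - 4 * Re w + 1"
    unfolding cmod_power2 by (simp add: power2_eq_square algebra_simps)
  with sq \<open>Re w < 1\<close> have "1\<^sup>2 < (cmod (2 * w - 1))\<^sup>2" by simp
  then show ?thesis by (rule power_less_imp_less_base) simp
qed

lemma peripheral_spectrum_of_asymp_pos:
  fixes A :: "complex^'n^'n"
  assumes fam: "spectral_family A E m" and bdd: "semigroup_bounded A" and pos: "semigroup_asymp_pos A"
  shows "peripheral_spectrum A = {complex_of_real (spectral_bound A)}"
proof -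
  let ?s = "complex_of_real (spectral_bound A)" and ?P = "peripheral_spectrum A"
  have PS: "?P \<subseteq> spectrum_mat A" by (auto simp: peripheral_spectrum_def)
  have fin: "finite ?P" by (rule finite_peripheral_spectrum[OF fam])
  have E: "E k *v (E l *v f) = (if k = l then E l *v f else 0)" if "k \<in> ?P" "l \<in> ?P" for k l f
    using spectral_family_eigenvector[OF fam peripheral_eigenvector[OF fam bdd that(2)]] that PS by blast
  have "l = ?s" if "l \<in> ?P" for l
  proof (rule ccontr)
    assume "l \<noteq> ?s"
    then obtain t where t: "exp (complex_of_real t * (l - ?s)) \<noteq> 1"
        "\<And>j. 2 *\<^sub>R peripheral_orbit A E t (axis j 1) - peripheral_orbit A E 0 (axis j 1) \<in> pos_cone"
      using peripheral_orbit_small_time[OF fam bdd pos \<open>l \<in> ?P\<close>] by blast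
    define z where "z = (\<lambda>l. 2 * exp (complex_of_real t * (l - ?s)) - 1)"
    define K where "K = (\<Sum>l\<in>?P. mat (z l) ** E l)"
    \<comment> \<open>Closed form of K^k S_0 f; mutual orthogonality of the peripheral
      \<open>E l\<close> gives the recursion through \<open>K\<close>.\<close>
    define h where "h = (\<lambda>k f. \<Sum>l\<in>?P. z l ^ k *s (E l *v f))"
    have lin: "linear (\<lambda>X::complex^'n^'n. X *v f)" for f
      by (rule linearI) (simp_all add: matrix_vector_mult_add_rdistrib)
    have K: "K *v f = (\<Sum>l\<in>?P. z l *s (E l *v f))" for f
      unfolding K_def linear_sum[OF lin] by (simp flip: matrix_vector_mul_assoc)
    have "K *v f = 2 *\<^sub>R peripheral_orbit A E t f - peripheral_orbit A E 0 f" for f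
      unfolding K z_def peripheral_orbit_def scaleR_eq_smult vec.scale_sum_right sum_subtractf[symmetric]
      by (intro sum.cong) (simp_all add: vec.scale_left_diff_distrib)
    then have "K *v axis j 1 \<in> pos_cone" for j
      using t(2)[of j] by simp
    then have Kpos: "K *v f \<in> pos_cone" if "f \<in> pos_cone" for f
      using that by (rule mult_vec_in_pos_cone)
    have h: "h k f \<in> pos_cone" if "f \<in> pos_cone" for k f
    proof (induction k)
      case 0
      show ?case
        using peripheral_orbit_in_pos_cone[OF fam bdd pos that, of 0]
        by (simp add: h_def peripheral_orbit_def)
    next
      case (Suc k)
      have "E l *v h k f = z l ^ k *s (E l *v f)" if l: "l \<in> ?P" for l
      proof -
        have "E l *v h k f = (\<Sum>l'\<in>?P. z l' ^ k *s (E l *v (E l' *v f)))"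
          by (simp add: h_def vec.linear_sum[OF matrix_vector_mul_linear_gen] vector_scalar_commute)
        also have "\<dots> = (\<Sum>l'\<in>?P. if l' = l then z l ^ k *s (E l *v f) else 0)"
          using l by (intro sum.cong) (auto simp: E)
        finally show ?thesis using l fin by simp
      qed
      then have "h (Suc k) f = K *v h k f"
        by (simp add: K h_def)
      with Kpos[OF Suc] show ?case by simp
    qed
    have "?P \<noteq> {}" using \<open>l \<in> ?P\<close> by auto
    have "Max ((\<lambda>l. cmod (z l)) ` ?P) \<in> (\<lambda>l. cmod (z l)) ` ?P"
      using fin \<open>?P \<noteq> {}\<close> by (intro Max_in) auto
    then obtain l1 where l1: "l1 \<in> ?P" "cmod (z l1) = Max ((\<lambda>l. cmod (z l)) ` ?P)" by auto
    have max: "cmod (z l) \<le> cmod (z l1)" if "l \<in> ?P" for l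
      unfolding l1(2) using fin that by (intro Max_ge) auto
    define r where "r = cmod (z l1)"
    have unit: "cmod (exp (complex_of_real t * (l - ?s))) = 1" if "l \<in> ?P" for l
      using that by (simp add: peripheral_spectrum_def)
    have "1 < cmod (z l)"
      unfolding z_def by (rule cmod_two_unit_minus_one[OF unit[OF \<open>l \<in> ?P\<close>] t(1)])
    then have r: "r > 1" using max[OF \<open>l \<in> ?P\<close>] by (simp add: r_def)
    define y where "y = (\<lambda>l. z l / complex_of_real r)"
    have y: "cmod (y l) \<le> 1" if "l \<in> ?P" for l
      using max[OF that] r by (simp add: y_def r_def norm_divide divide_le_eq)
    have "cmod (y l1) = 1"
      using r by (auto simp: y_def r_def norm_divide)
    \<comment> \<open>y l = 1 would mean that a number of modulus 2 equals r + 1 > 2.\<close>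
    have no1: "y l \<noteq> 1" if "l \<in> ?P" for l
    proof
      assume "y l = 1"
      then have "z l = complex_of_real r" using r by (simp add: y_def)
      then have "2 * exp (complex_of_real t * (l - ?s)) = complex_of_real (r + 1)"
        by (simp add: z_def algebra_simps)
      then have "cmod (2 * exp (complex_of_real t * (l - ?s))) = r + 1"
        using r by (simp only: norm_of_real)
      then show False using r unfolding norm_mult unit[OF that] by simp
    qed
    let ?J = "{l \<in> ?P. y l = y l1}"
    have zero: "(\<Sum>l\<in>?J. E l *v f) = 0" if "f \<in> pos_cone" for f
    proof -
      have "(\<Sum>l\<in>?P. y l ^ k *s (E l *v f)) \<in> pos_cone" for k
      proof -
        have "(\<Sum>l\<in>?P. y l ^ k *s (E l *v f)) = (1 / r ^ k) *\<^sub>R h k f"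
          by (simp add: h_def y_def scaleR_eq_smult vec.scale_sum_right power_divide)
        with h[OF that, of k] r show ?thesis by (simp add: in_pos_cone_iff)
      qed
      then have "(\<lambda>k. d_plus (\<Sum>l\<in>?P. y l ^ k *s (E l *v f))) \<longlonglongrightarrow> 0"
        by (simp add: d_plus_eq_0_iff[THEN iffD2])
      from asymptotically_positive_peripheral_bound[OF fin y \<open>cmod (y l1) = 1\<close> this]
      have bound: "cmod ((\<Sum>l\<in>?J. E l *v f) $ j) \<le> Re ((\<Sum>l | l \<in> ?P \<and> y l = 1. E l *v f) $ j)" for j .
      have empty: "{l. l \<in> ?P \<and> y l = 1} = {}" using no1 by auto
      have "cmod ((\<Sum>l\<in>?J. E l *v f) $ j) \<le> 0" for j
        using bound[of j] unfolding empty sum.empty zero_index by (simp only: zero_complex.sel)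
      then show ?thesis unfolding vec_eq_iff zero_index norm_le_zero_iff by blast
    qed
    obtain j where j: "E l1 *v axis j 1 \<noteq> 0"
      using spectral_family_nonzero[OF fam] l1(1) PS by blast
    \<comment> \<open>Distinct peripheral eigenvalues can share the value \<open>y l1\<close>, so
      only the sum over \<open>?J\<close> is known to vanish; applying \<open>E l1\<close> isolates
      the single term.\<close>
    have "E l1 *v (\<Sum>l\<in>?J. E l *v axis j 1) = (\<Sum>l\<in>?J. if l = l1 then E l1 *v axis j 1 else 0)"
      unfolding vec.linear_sum[OF matrix_vector_mul_linear_gen]
      using l1(1) by (intro sum.cong) (auto simp: E)
    also have "\<dots> = E l1 *v axis j 1"
      using l1(1) fin by simp
    finally show False using zero[of "axis j 1"] j by simp
  qed
  moreover have "?P \<noteq> {}"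
    using spectral_bound_attained[OF fam] by (auto simp: peripheral_spectrum_def)
  ultimately show ?thesis by auto
qed

subsection \<open>Semigroup versus shifted matrix\<close>

lemma semigroup_asymp_pos_of_convergent:
  assumes "\<And>f. f \<in> pos_cone \<Longrightarrow> g f \<in> pos_cone"
    and "\<And>f. ((\<lambda>t. mexp t (A - mat (complex_of_real (spectral_bound A))) *v f - g f) \<longlongrightarrow> 0) at_top"
  shows "semigroup_asymp_pos A"
  unfolding semigroup_asymp_pos_def d_plus_tendsto_iff[OF assms(2)]
  using assms(1) by (simp add: d_plus_eq_0_iff[THEN iffD2])

lemma mexp_converges_of_trivial_peripheral_spectrum:
  fixes A :: "complex^'n^'n"
  assumes "spectral_family A E m" and "semigroup_bounded A"
    and "peripheral_spectrum A = {complex_of_real (spectral_bound A)}"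
  shows "((\<lambda>t. mexp t (A - mat (complex_of_real (spectral_bound A))) *v f
    - E (spectral_bound A) *v f) \<longlongrightarrow> 0) at_top"
  using mexp_peripheral_asymptotics[OF assms(1,2), of f]
  by (simp add: peripheral_orbit_def assms(3))

lemma spectral_radius_add_mat:
  "spectral_radius_mat (A + mat c) = Max ((\<lambda>l. cmod (l + c)) ` spectrum_mat A)"
  by (simp add: spectral_radius_mat_def spectrum_add_mat image_image)

text \<open>|l + c|^2 = |l|^2 + 2 c Re l + c^2 drops below c^2 as soon as c > |l|^2 / (-2 Re
  l).\<close>

lemma exists_shift_dominating:
  fixes S :: "complex set"
  assumes "finite S" and "\<And>l. l \<in> S \<Longrightarrow> Re l < 0"
  shows "\<exists>c>0. \<forall>l\<in>S. cmod (l + complex_of_real c) < c"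
proof -
  have "\<forall>\<^sub>F c in at_top. cmod (l + complex_of_real c) < c" if "l \<in> S" for l
    using eventually_gt_at_top[of "(cmod l)\<^sup>2 / (-2 * Re l)"] eventually_gt_at_top[of 0]
  proof eventually_elim
    case (elim c)
    have "(cmod l)\<^sup>2 < c * (-2 * Re l)"
      using elim(1) assms(2)[OF that] by (simp only: pos_divide_less_eq)
    moreover have "(cmod (l + complex_of_real c))\<^sup>2 = (cmod l)\<^sup>2 + 2 * c * Re l + c\<^sup>2"
      unfolding cmod_power2 by (simp add: power2_eq_square algebra_simps)
    ultimately have "(cmod (l + complex_of_real c))\<^sup>2 < c\<^sup>2" by simp
    then show ?case using elim(2) by (auto intro: power_less_imp_less_base)
  qed
  then have "\<forall>\<^sub>F c in at_top. \<forall>l\<in>S. cmod (l + complex_of_real c) < c"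
    using assms(1) by (intro eventually_ball_finite) auto
  then have "\<forall>\<^sub>F c in at_top. c > 0 \<and> (\<forall>l\<in>S. cmod (l + complex_of_real c) < c)"
    using eventually_gt_at_top[of 0] by eventually_elim simp
  then show ?thesis
    using eventually_happens'[OF trivial_limit_at_top_linorder] by blast
qed

text \<open>Only s is peripheral, so a suitable shift makes it strictly dominant. The normalized
  powers then converge to \<open>E s\<close>, which yields power boundedness, and \<open>E s\<close>
  = S_0 is positive.\<close>

lemma shifted_matrix_of_asymp_pos:
  fixes A :: "complex^'n^'n"
  assumes fam: "spectral_family A E m" and bdd: "semigroup_bounded A" and pos: "semigroup_asymp_pos A"
  shows "\<exists>c::real. spectral_radius_mat (A + mat (complex_of_real c)) > 0
    \<and> power_bounded ((1 / spectral_radius_mat (A + mat (complex_of_real c))) *\<^sub>R (A + mat (complex_of_real c)))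
    \<and> matrix_asymp_pos (A + mat (complex_of_real c))"
proof -
  define s where "s = spectral_bound A"
  let ?S = "spectrum_mat A"
  have P: "peripheral_spectrum A = {complex_of_real s}"
    unfolding s_def by (rule peripheral_spectrum_of_asymp_pos[OF assms])
  then have sS: "complex_of_real s \<in> ?S" by (auto simp: peripheral_spectrum_def)
  have neg: "Re l < s" if "l \<in> ?S - {complex_of_real s}" for l
    using that P spectral_bound_ge[OF fam, of l] unfolding peripheral_spectrum_def s_def
    by (cases "Re l = spectral_bound A") auto
  let ?D = "(\<lambda>l. l - complex_of_real s) ` (?S - {complex_of_real s})"
  have finD: "finite ?D"
    using spectral_family_spectrum(1)[OF fam] by simp
  have negD: "Re x < 0" if "x \<in> ?D" for x
    using that neg by fastforce
  obtain r where r: "r > 0" "\<And>x. x \<in> ?D \<Longrightarrow> cmod (x + complex_of_real r) < r"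
    using exists_shift_dominating[OF finD negD] by blast
  \<comment> \<open>Moves s to r and every other eigenvalue into the open disc of radius r about
    0.\<close>
  define c where "c = r - s"
  have dom: "cmod (l + complex_of_real c) < r" if "l \<in> ?S - {complex_of_real s}" for l
    using r(2)[OF imageI[OF that]] by (simp add: c_def algebra_simps)
  have eq: "cmod (complex_of_real s + complex_of_real c) = r"
    using r(1) by (simp add: c_def)
  have radius: "spectral_radius_mat (A + mat (complex_of_real c)) = r"
    unfolding spectral_radius_add_mat
  proof (rule Max_eqI)
    show "finite ((\<lambda>l. cmod (l + complex_of_real c)) ` ?S)"
      using spectral_family_spectrum(1)[OF fam] by simp
    show "r \<in> (\<lambda>l. cmod (l + complex_of_real c)) ` ?S"
      using sS eq by (metis imageI)
    show "y \<le> r" if "y \<in> (\<lambda>l. cmod (l + complex_of_real c)) ` ?S" for y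
      using that dom eq less_imp_le by blast
  qed
  let ?T = "(1 / r) *\<^sub>R (A + mat (complex_of_real c))"
  have conv: "(\<lambda>k. mpow ?T k *v f - E s *v f) \<longlonglongrightarrow> 0" for f
  proof -
    have "(\<lambda>k. mpow ?T k *v f - (\<Sum>l\<in>{complex_of_real s}.
        (complex_of_real (1 / r) * (l + complex_of_real c)) ^ k *s (E l *v f))) \<longlonglongrightarrow> 0"
    proof (rule mpow_peripheral_asymptotics[OF fam])
      show "cmod (complex_of_real (1 / r) * (l + complex_of_real c)) < 1"
        if "l \<in> ?S - {complex_of_real s}" for l
        using dom[OF that] r(1) by (simp add: norm_mult norm_divide)
      show "A *v (E l *v f) = l *s (E l *v f)" if "l \<in> {complex_of_real s}" for l
        using that P by (intro peripheral_eigenvector[OF fam bdd]) simp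
    qed (use sS in auto)
    moreover have "complex_of_real (1 / r) * (complex_of_real s + complex_of_real c) = 1"
      using r(1) by (simp add: c_def)
    ultimately show ?thesis by simp
  qed
  have "convergent (\<lambda>k. mpow ?T k *v f)" for f
    using conv[of f] by (auto simp: convergent_def LIM_zero_iff)
  then have "power_bounded ?T" by (rule power_bounded_of_convergent)
  moreover have "E s *v f \<in> pos_cone" if "f \<in> pos_cone" for f
    using peripheral_orbit_in_pos_cone[OF assms that, of 0]
    by (simp add: peripheral_orbit_def P)
  then have "matrix_asymp_pos (A + mat (complex_of_real c))"
    unfolding matrix_asymp_pos_def radius d_plus_tendsto_iff[OF conv]
    by (simp add: d_plus_eq_0_iff[THEN iffD2])
  ultimately show ?thesis using r(1) radius by metis
qed

text \<open>The spectrum of the shifted matrix lies in the closed disc of radius r. Once r itself is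
  an eigenvalue, it is the rightmost one and alone on its vertical line, so the rescaled semigroup
  converges to its projection.\<close>

lemma asymp_pos_of_shifted_matrix:
  fixes A :: "complex^'n^'n" and c :: real
  assumes fam: "spectral_family A E m" and bdd: "semigroup_bounded A"
    and r0: "spectral_radius_mat (A + mat (complex_of_real c)) > 0"
    and pb: "power_bounded ((1 / spectral_radius_mat (A + mat (complex_of_real c))) *\<^sub>R (A + mat (complex_of_real c)))"
    and pos: "matrix_asymp_pos (A + mat (complex_of_real c))"
  shows "semigroup_asymp_pos A"
proof -
  define r where "r = spectral_radius_mat (A + mat (complex_of_real c))"
  have r: "r > 0" using r0 by (simp add: r_def)
  let ?S = "spectrum_mat A" and ?T = "(1 / r) *\<^sub>R (A + mat (complex_of_real c))"
  have S: "finite ?S" "?S \<noteq> {}" by (rule spectral_family_spectrum[OF fam])+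
  define z where "z = (\<lambda>l. complex_of_real (1 / r) * (l + complex_of_real c))"
  define I where "I = {l \<in> ?S. cmod (z l) = 1}"
  have IS: "I \<subseteq> ?S" by (auto simp: I_def)
  have finI: "finite I" using IS S(1) by (rule finite_subset)
  have cz: "cmod (z l) = cmod (l + complex_of_real c) / r" for l
    using r by (simp add: z_def norm_mult norm_divide)
  have le: "cmod (l + complex_of_real c) \<le> r" if "l \<in> ?S" for l
    unfolding r_def spectral_radius_add_mat using S that by (intro Max_ge) auto
  have z: "cmod (z l) \<le> 1" if "l \<in> ?S" for l
    using le[OF that] r by (simp add: cz)
  have "r \<in> (\<lambda>l. cmod (l + complex_of_real c)) ` ?S"
    unfolding r_def spectral_radius_add_mat using S by (intro Max_in) auto
  then obtain l0 where l0: "l0 \<in> I"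
    using r by (auto simp: I_def cz)
  obtain M where M: "\<And>k f. norm (mpow ?T k *v f) \<le> M * norm f"
    using pb unfolding power_bounded_def r_def by blast
  \<comment> \<open>Power boundedness excludes Jordan blocks on the unit circle; the eigenvalues in
    \<open>I\<close> need not be peripheral for \<open>A\<close>, so \<open>bdd\<close> does not
    give this.\<close>
  have eig: "A *v (E l *v f) = l *s (E l *v f)" if l: "l \<in> I" for l f
  proof -
    have shift: "?T - mat (z l) = (1 / r) *\<^sub>R (A - mat l)"
      by (simp add: vec_eq_iff mat_def z_def)
        (simp add: scaleR_conv_of_real add_divide_distrib diff_divide_distrib)
    have "?T *v (E l *v f) = z l *s (E l *v f)"
    proof (rule semisimple_of_bounded_mpow[OF M])
      show "cmod (z l) = 1" using l by (simp add: I_def)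
      show "((*v) (?T - mat (z l)) ^^ m l) (E l *v f) = 0"
        unfolding shift funpow_scaleR_mult_vec using fam l IS by (auto simp: spectral_family_def)
    qed
    then have "r *\<^sub>R (?T *v (E l *v f)) = r *\<^sub>R (z l *s (E l *v f))" by simp
    then have "A *v (E l *v f) + complex_of_real c *s (E l *v f) = (l + complex_of_real c) *s (E l *v f)"
      using r by (simp add: matrix_vector_mult_add_rdistrib z_def) (simp add: scaleR_eq_smult)
    then show ?thesis by (simp add: vec.scale_left_distrib)
  qed
  have bound: "cmod ((\<Sum>l | l \<in> I \<and> z l = w. E l *v f) $ i) \<le> Re ((\<Sum>l | l \<in> I \<and> z l = 1. E l *v f) $ i)"
    if "f \<in> pos_cone" "cmod w = 1" for f w i
  proof (rule asymptotically_positive_peripheral_bound[OF finI _ that(2)])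
    show "cmod (z l) \<le> 1" if "l \<in> I" for l using z IS that by blast
    have "(\<lambda>k. mpow ?T k *v f - (\<Sum>l\<in>I. z l ^ k *s (E l *v f))) \<longlonglongrightarrow> 0"
      unfolding z_def
    proof (rule mpow_peripheral_asymptotics[OF fam _ IS eig])
      show "cmod (complex_of_real (1 / r) * (l + complex_of_real c)) < 1" if "l \<in> ?S - I" for l
        using z[of l] that by (force simp: I_def z_def)
    qed
    moreover have "(\<lambda>k. d_plus (mpow ?T k *v f)) \<longlonglongrightarrow> 0"
      using pos that(1) by (simp add: matrix_asymp_pos_def r_def)
    ultimately show "(\<lambda>k. d_plus (\<Sum>l\<in>I. z l ^ k *s (E l *v f))) \<longlonglongrightarrow> 0"
      by (simp only: d_plus_tendsto_iff)
  qed
  \<comment> \<open>\<open>z\<close> is affine with nonzero slope, so fibres are singletons and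
    \<open>bound\<close> compares individual projections.\<close>
  have inj: "z l = z l' \<longleftrightarrow> l = l'" for l l'
    using r by (simp add: z_def)
  have fiber: "{l. l \<in> I \<and> z l = z l'} = {l'}" if "l' \<in> I" for l'
    using that by (auto simp: inj)
  define l1 where "l1 = complex_of_real (r - c)"
  have z1: "z l1 = 1" using r by (simp add: z_def l1_def)
  have l1: "l1 \<in> I"
  proof (rule ccontr)
    assume "l1 \<notin> I"
    \<comment> \<open>With no eigenvalue at 1 the dominating sum is empty, so the projection at
      \<open>l0\<close> would vanish.\<close>
    then have "z l \<noteq> 1" if "l \<in> I" for l
      using inj[of l l1] that unfolding z1 by blast
    then have empty: "{l. l \<in> I \<and> z l = 1} = {}" by blast
    have "E l0 *v axis j 1 = 0" for j
    proof -
      have "cmod ((E l0 *v axis j 1) $ i) \<le> 0" for i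
        using bound[of "axis j 1" "z l0" i] l0 unfolding empty fiber[OF l0] by (simp add: I_def)
      then show ?thesis by (simp add: vec_eq_iff)
    qed
    then show False using spectral_family_nonzero[OF fam, of l0] l0 IS by blast
  qed
  have E1: "E l1 *v f \<in> pos_cone" if "f \<in> pos_cone" for f
  proof -
    \<comment> \<open>|x| \<le> Re x describes exactly the nonnegative reals; the case w = 1 of
      \<open>bound\<close> supplies it for each coordinate.\<close>
    have "Im x = 0 \<and> 0 \<le> Re x" if "cmod x \<le> Re x" for x
    proof -
      have "(cmod x)\<^sup>2 \<le> (Re x)\<^sup>2" using that by (rule power_mono) simp
      then have "(Im x)\<^sup>2 \<le> 0" unfolding cmod_power2 by simp
      moreover have "0 \<le> Re x" using that norm_ge_zero[of x] by linarith
      ultimately show ?thesis by simp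
    qed
    moreover have "cmod ((E l1 *v f) $ i) \<le> Re ((E l1 *v f) $ i)" for i
      using bound[OF that, of 1 i] fiber[OF l1] unfolding z1 by simp
    ultimately show ?thesis by (simp add: in_pos_cone_iff)
  qed
  have Re_le: "Re l \<le> r - c" if "l \<in> ?S" for l
    using le[OF that] complex_Re_le_cmod[of "l + complex_of_real c"] by simp
  have s: "spectral_bound A = r - c"
    unfolding spectral_bound_def
  proof (rule Max_eqI)
    show "r - c \<in> Re ` ?S" using l1 IS unfolding l1_def by force
  qed (use S(1) Re_le in auto)
  \<comment> \<open>The vertical line through r meets the closed disc of radius r only in r.\<close>
  have "l = l1" if "l \<in> peripheral_spectrum A" for l
  proof -
    have l: "l \<in> ?S" "Re (l + complex_of_real c) = r"
      using that by (auto simp: peripheral_spectrum_def s)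
    then have "(cmod (l + complex_of_real c))\<^sup>2 \<le> r\<^sup>2"
      using le by (intro power_mono) auto
    then have "(Im l)\<^sup>2 \<le> 0"
      unfolding cmod_power2 l(2) by simp
    then show ?thesis using l(2) by (simp add: complex_eq_iff l1_def)
  qed
  moreover have "l1 \<in> peripheral_spectrum A"
    using l1 IS by (auto simp: peripheral_spectrum_def s l1_def)
  ultimately have P: "peripheral_spectrum A = {complex_of_real (spectral_bound A)}"
    unfolding s l1_def by blast
  show ?thesis
  proof (rule semigroup_asymp_pos_of_convergent)
    show "E (complex_of_real (spectral_bound A)) *v f \<in> pos_cone" if "f \<in> pos_cone" for f
      using E1[OF that] unfolding s l1_def .
  qed (rule mexp_converges_of_trivial_peripheral_spectrum[OF fam bdd P])
qed

theorem theorem9p1: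
  fixes A :: "complex^'n^'n"
  assumes "semigroup_bounded A"
  shows "semigroup_asymp_pos A \<longleftrightarrow>
    (\<exists>c::real. spectral_radius_mat (A + mat (complex_of_real c)) > 0
       \<and> power_bounded ((1 / spectral_radius_mat (A + mat (complex_of_real c))) *\<^sub>R (A + mat (complex_of_real c)))
       \<and> matrix_asymp_pos (A + mat (complex_of_real c)))"
proof -
  obtain E m where "spectral_family A E m"
    by (rule spectral_family_exists)
  with assms show ?thesis
    using shifted_matrix_of_asymp_pos asymp_pos_of_shifted_matrix by blast
qed

end
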